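(* Let $f:\mathbb{R}^n\to\mathbb{R}$ be a convex function whose gradient is Lipschitz continuous with respect to $\|\cdot\|_2$ with constant $L_f$, and let $x_\star$ be a solution of $\min_{y\in\mathbb{R}^n} f(y)$. Let $0<L_d<L_u$ satisfy $L_d\le L_f\le L_u$. Consider the Adaptive Catalyst algorithm (defined in the context) with bounds $L_d, L_u$ for solving $\min_{y\in\mathbb{R}^n} f(y)$, with an auxiliary (inner) non-accelerated method $\mathcal{M}$ that satisfies the convergence rate assumption (stated in the context) with constants $C_n$ and $L_f$. Let $R=\|y^0-x_\star\|_2$, let $\varepsilon>0$ and $\delta\in(0,1)$. Then, with probability at least $1-\delta$, the total complexity of the Adaptive Catalyst algorithm with inner method $\mathcal{M}$, i.e. the total number of oracle calls (iterations) of $\mathcal{M}$ required to find an $\varepsilon$-solution in terms of function value (a point $y^N$ with $f(y^N)-f(x_\star)\le\varepsilon$), is $$\tilde{O}\left(C_n\cdot\max\left\{\sqrt{\frac{L_u}{L_f}},\sqrt{\frac{L_f}{L_d}}\right\}\cdot\sqrt{\frac{L_fR^2}{\varepsilon}}\right).$$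
   Context: Notation. For $L>0$ and $x\in\mathbb{R}^n$ put $F_{L,x}(y)=f(y)+\frac{L}{2}\|y-x\|_2^2$. The function $F_{L,x}$ is $L$-strongly convex and its gradient is $(L+L_f)$-Lipschitz. $\tilde{O}(\cdot)$ means the same as $O(\cdot)$ up to a logarithmic factor (logarithmic in the quantities of the problem such as $1/\varepsilon$, $1/\delta$, $L_u/L_d$, $L_f$, $R$, $C_n$); the algorithm parameters $\alpha,\beta,\gamma$ below are treated as constants. Convergence rate assumption on the inner method $\mathcal{M}$. Applied to $\min_{y\in\mathbb{R}^n}F(y)$, where $F$ is $\mu_F$-strongly convex with smoothness constant $L_F$, with starting point $y^0$ and solution $y_\star$, and with $R_y=\|y^0-y_\star\|_2$, the point $y_t$ produced by $\mathcal{M}$ after $t$ iterations (oracle calls) satisfies, with probability at least $1-\delta$, $$F(y_t)-F(y_\star)=O\left(L_FR_y^2\ln\tfrac{t}{\delta}\right)\min\left\{\tfrac{C_n}{t},\exp\left(-\tfrac{\mu_Ft}{C_nL_F}\right)\right\}.$$ For deterministic methods the phrase "with probability at least $1-\delta$" and the logarithmic factor are dropped. For the auxiliary functions $F=F_{L,x}$ one has $\mu_F=L$ and $L_F=L_f+L$. Adaptive Catalyst algorithm. Parameters: starting point $x^0=y^0=z^0\in\mathbb{R}^n$; initial guess $L_0>0$; numbers $\alpha>\beta\gtrsim\gamma>1$; bounds $0<L_d<L_u$; inner method $\mathcal{M}$; $A_0=0$. For $k=0,1,\dots,N-1$: 1. Set $L_{k+1}=\beta\cdot\min\{\alpha L_k,L_u\}$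 and $r=0$. 2. Repeat the following: (a) $r:=r+1$ and $L_{k+1}:=\max\{L_{k+1}/\beta,\,L_d\}$; (b) compute $a_{k+1}=\frac{1/L_{k+1}+\sqrt{1/L_{k+1}^2+4A_k/L_{k+1}}}{2}$, $A_{k+1}=A_k+a_{k+1}$, $x^{k+1}=\frac{A_k}{A_{k+1}}y^k+\frac{a_{k+1}}{A_{k+1}}z^k$; (c) run $\mathcal{M}$ on $\min_yF_{L_{k+1},x^{k+1}}(y)$ from the starting point $x^{k+1}$ until its output point $y^{k+1}$ satisfies $\|\nabla F_{L_{k+1},x^{k+1}}(y^{k+1})\|_2\le\frac{L_{k+1}}{2}\|y^{k+1}-x^{k+1}\|_2$; let $N_r$ be the number of iterations of $\mathcal{M}$ used; until ($r>1$ and $N_r\ge\gamma N_{r-1}$) or $L_{k+1}=L_d$. 3. Set $z^{k+1}=z^k-a_{k+1}\nabla f(y^{k+1})$. Output: $y^N$. All iterations of $\mathcal{M}$, over all outer iterations $k$ and all inner restarts $r$, are counted in the total complexity.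
   Formalization: Assumes C_n ≥ 1 and, unless R = 0, ε ≤ κ·L_d·R² for an arbitrary κ > 0, the hidden constant growing like 1+√κ; a constant uniform in all ε is impossible, as the first outer iteration with L = L_d may alone cost about C_n·L_f/L_d calls. *)

theory Defs
  imports "HOL-Probability.Probability"
begin

section \<open>Auxiliary objectives\<close>

definition grad :: "('a::real_inner \<Rightarrow> real) \<Rightarrow> 'a \<Rightarrow> 'a" where
  "grad f x = (THE D. GDERIV f x :> D)"

definition smooth_fun :: "real \<Rightarrow> ('a::real_inner \<Rightarrow> real) \<Rightarrow> bool" where
  "smooth_fun L f \<longleftrightarrow> (\<forall>x. \<exists>D. GDERIV f x :> D) \<and> L-lipschitz_on UNIV (grad f)"

definition aux_fun :: "('a::real_inner \<Rightarrow> real) \<Rightarrow> real \<Rightarrow> 'a \<Rightarrow> 'a \<Rightarrow> real" where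
  "aux_fun f L x y = f y + L / 2 * (norm (y - x))\<^sup>2"

section \<open>Inner methods\<close>

text \<open>
  An inner method is a function \<open>M\<close>, where \<open>M F y0 s t\<close> is the point produced after \<open>t\<close>
  iterations on the objective \<open>F\<close> from the starting point \<open>y0\<close>, and \<open>s\<close> is the
  random seed of the whole run, distributed according to a probability measure \<open>S\<close>.
  The method sees the objective as a function, and so has access to any oracle for it.
\<close>

type_synonym ('a, 's) inner_method = "('a \<Rightarrow> real) \<Rightarrow> 'a \<Rightarrow> 's \<Rightarrow> nat \<Rightarrow> 'a"

definition rate :: "real \<Rightarrow> real \<Rightarrow> real \<Rightarrow> nat \<Rightarrow> real" where
  "rate C\<^sub>n \<mu> L\<^sub>F t = min (C\<^sub>n / real t) (exp (- (\<mu> * real t / (C\<^sub>n * L\<^sub>F))))"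

text \<open>
  \<open>C\<close> is the constant hidden in the \<open>O\<close> of the rate. Only \<open>\<delta> \<le> 1/2\<close> is required:
  near \<open>\<delta> = 1\<close>, \<open>t = 1\<close> the factor \<open>ln (t / \<delta>)\<close> vanishes, and the requirement
  would be one that the usual randomized methods do not meet.
\<close>

definition randomized_rate ::
  "'s measure \<Rightarrow> ('a::euclidean_space, 's) inner_method \<Rightarrow> real \<Rightarrow> real \<Rightarrow> ('a \<Rightarrow> real) \<Rightarrow> real \<Rightarrow> real \<Rightarrow> bool"
where
  "randomized_rate S M C C\<^sub>n F \<mu> L\<^sub>F \<longleftrightarrow>
    (\<forall>y0 ystar t \<delta>. (\<forall>y. F ystar \<le> F y) \<longrightarrow> 1 \<le> t \<longrightarrow> 0 < \<delta> \<longrightarrow> \<delta> \<le> 1 / 2 \<longrightarrow>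
      measure S {s \<in> space S. F (M F y0 s t) - F ystar
        \<le> C * L\<^sub>F * (norm (y0 - ystar))\<^sup>2 * ln (real t / \<delta>) * rate C\<^sub>n \<mu> L\<^sub>F t} \<ge> 1 - \<delta>)"

definition deterministic_rate ::
  "'s measure \<Rightarrow> ('a::euclidean_space, 's) inner_method \<Rightarrow> real \<Rightarrow> real \<Rightarrow> ('a \<Rightarrow> real) \<Rightarrow> real \<Rightarrow> real \<Rightarrow> bool"
where
  "deterministic_rate S M C C\<^sub>n F \<mu> L\<^sub>F \<longleftrightarrow>
    (\<forall>y0 t. \<forall>s\<in>space S. \<forall>s'\<in>space S. M F y0 s t = M F y0 s' t) \<and>
    (\<forall>y0 ystar t. \<forall>s\<in>space S. (\<forall>y. F ystar \<le> F y) \<longrightarrow> 1 \<le> t \<longrightarrow>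
      F (M F y0 s t) - F ystar \<le> C * L\<^sub>F * (norm (y0 - ystar))\<^sup>2 * rate C\<^sub>n \<mu> L\<^sub>F t)"

text \<open>
  The rate is required for the auxiliary functions of \<open>f\<close>, which are \<open>L\<close>-strongly convex with
  an \<open>(L\<^sub>f + L)\<close>-Lipschitz gradient. A randomized method must depend measurably on \<open>L\<close>, \<open>x\<close> and
  the seed, as the parameters of a run are themselves random.
\<close>

definition rate_assumption ::
  "'s measure \<Rightarrow> ('a::euclidean_space, 's) inner_method \<Rightarrow> real \<Rightarrow> real \<Rightarrow> ('a \<Rightarrow> real) \<Rightarrow> real \<Rightarrow> bool"
where
  "rate_assumption S M C C\<^sub>n f L\<^sub>f \<longleftrightarrow>
    ((\<forall>t. (\<lambda>(L, x, s). M (aux_fun f L x) x s t)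
        \<in> borel_measurable (restrict_space borel {0<..} \<Otimes>\<^sub>M (borel \<Otimes>\<^sub>M S))) \<and>
     (\<forall>L>0. \<forall>x. randomized_rate S M C C\<^sub>n (aux_fun f L x) L (L\<^sub>f + L)))
    \<or> (\<forall>L>0. \<forall>x. deterministic_rate S M C C\<^sub>n (aux_fun f L x) L (L\<^sub>f + L))"

section \<open>Adaptive Catalyst\<close>

definition stop_crit :: "('a::real_inner \<Rightarrow> real) \<Rightarrow> real \<Rightarrow> 'a \<Rightarrow> 'a \<Rightarrow> bool" where
  "stop_crit f L x y \<longleftrightarrow> norm (grad (aux_fun f L x) y) \<le> L / 2 * norm (y - x)"

text \<open>
  \<open>inner_run f M L x s n y\<close>: the run with seed \<open>s\<close> takes exactly \<open>n \<ge> 1\<close> iterations and returns \<open>y\<close>.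
  If the criterion is never met, there are no such \<open>n\<close> and \<open>y\<close>.
\<close>

definition inner_run ::
  "('a::real_inner \<Rightarrow> real) \<Rightarrow> ('a, 's) inner_method \<Rightarrow> real \<Rightarrow> 'a \<Rightarrow> 's \<Rightarrow> nat \<Rightarrow> 'a \<Rightarrow> bool"
where
  "inner_run f M L x s n y \<longleftrightarrow>
    1 \<le> n \<and> y = M (aux_fun f L x) x s n \<and> stop_crit f L x y \<and>
    (\<forall>t. 1 \<le> t \<and> t < n \<longrightarrow> \<not> stop_crit f L x (M (aux_fun f L x) x s t))"

definition step_a :: "real \<Rightarrow> real \<Rightarrow> real" where
  "step_a A L = (1 / L + sqrt (1 / L\<^sup>2 + 4 * A / L)) / 2"

definition step_x :: "real \<Rightarrow> 'a::real_vector \<Rightarrow> 'a \<Rightarrow> real \<Rightarrow> 'a" where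
  "step_x A y z L =
    (A / (A + step_a A L)) *\<^sub>R y + (step_a A L / (A + step_a A L)) *\<^sub>R z"

text \<open>
  \<open>passes f M \<beta> \<gamma> L\<^sub>d Linit A y z \<sigma> r L n y' T b\<close>: the \<open>r\<close>-th pass through the
  repeat-until loop of one outer iteration is made, with the value \<open>L\<close>; its inner run takes \<open>n\<close>
  iterations and returns \<open>y'\<close>; the passes \<open>1, \<dots>, r\<close> take \<open>T\<close> iterations in total; and
  \<open>b\<close> tells whether the loop is left after this pass. \<open>Linit\<close> is the value of \<open>L\<close> before the loop
  and \<open>\<sigma> r\<close> is the seed of the \<open>r\<close>-th inner run.
\<close>

inductive passes ::
  "('a::real_inner \<Rightarrow> real) \<Rightarrow> ('a, 's) inner_method \<Rightarrow> real \<Rightarrow> real \<Rightarrow> real \<Rightarrow> real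
    \<Rightarrow> real \<Rightarrow> 'a \<Rightarrow> 'a \<Rightarrow> (nat \<Rightarrow> 's) \<Rightarrow> nat \<Rightarrow> real \<Rightarrow> nat \<Rightarrow> 'a \<Rightarrow> nat \<Rightarrow> bool \<Rightarrow> bool"
  for f M \<beta> \<gamma> L\<^sub>d Linit A y z \<sigma>
where
  first: "L = max (Linit / \<beta>) L\<^sub>d \<Longrightarrow> inner_run f M L (step_x A y z L) (\<sigma> 1) n y' \<Longrightarrow>
    passes f M \<beta> \<gamma> L\<^sub>d Linit A y z \<sigma> 1 L n y' n (L = L\<^sub>d)"
| again: "passes f M \<beta> \<gamma> L\<^sub>d Linit A y z \<sigma> r L n y' T False \<Longrightarrow>
    L' = max (L / \<beta>) L\<^sub>d \<Longrightarrow> inner_run f M L' (step_x A y z L') (\<sigma> (Suc r)) n' y'' \<Longrightarrow>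
    passes f M \<beta> \<gamma> L\<^sub>d Linit A y z \<sigma> (Suc r) L' n' y'' (T + n')
      (real n' \<ge> \<gamma> * real n \<or> L' = L\<^sub>d)"

text \<open>
  \<open>catalyst f M \<alpha> \<beta> \<gamma> L\<^sub>d L\<^sub>u L0 x0 \<omega> k L A y z T\<close>: after \<open>k\<close> outer iterations the
  algorithm has \<open>L\<^sub>k = L\<close>, \<open>A\<^sub>k = A\<close>, \<open>y\<^sup>k = y\<close>, \<open>z\<^sup>k = z\<close>, and all inner runs
  so far, rejected ones included, have taken \<open>T\<close> iterations in total. The \<open>r\<close>-th inner run of
  the outer iteration \<open>k\<close> has the seed \<open>\<omega> (k, r)\<close>.
\<close>

inductive catalyst ::
  "('a::real_inner \<Rightarrow> real) \<Rightarrow> ('a, 's) inner_method \<Rightarrow> real \<Rightarrow> real \<Rightarrow> real \<Rightarrow> real \<Rightarrow> real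
    \<Rightarrow> real \<Rightarrow> 'a \<Rightarrow> (nat \<times> nat \<Rightarrow> 's) \<Rightarrow> nat \<Rightarrow> real \<Rightarrow> real \<Rightarrow> 'a \<Rightarrow> 'a \<Rightarrow> nat \<Rightarrow> bool"
  for f M \<alpha> \<beta> \<gamma> L\<^sub>d L\<^sub>u L0 x0 \<omega>
where
  init: "catalyst f M \<alpha> \<beta> \<gamma> L\<^sub>d L\<^sub>u L0 x0 \<omega> 0 L0 0 x0 x0 0"
| step: "catalyst f M \<alpha> \<beta> \<gamma> L\<^sub>d L\<^sub>u L0 x0 \<omega> k L A y z T \<Longrightarrow>
    passes f M \<beta> \<gamma> L\<^sub>d (\<beta> * min (\<alpha> * L) L\<^sub>u) A y z (\<lambda>r. \<omega> (k, r)) r L' n y' T' True \<Longrightarrow>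
    catalyst f M \<alpha> \<beta> \<gamma> L\<^sub>d L\<^sub>u L0 x0 \<omega> (Suc k) L' (A + step_a A L') y'
      (z - step_a A L' *\<^sub>R grad f y') (T + T')"

text \<open>Independent seeds for all inner runs.\<close>

definition seeds :: "'s measure \<Rightarrow> (nat \<times> nat \<Rightarrow> 's) measure" where
  "seeds S = Pi\<^sub>M UNIV (\<lambda>_. S)"

section \<open>The complexity bound\<close>

definition log_factor :: "real \<Rightarrow> real \<Rightarrow> real \<Rightarrow> real \<Rightarrow> real \<Rightarrow> real \<Rightarrow> real \<Rightarrow> real" where
  "log_factor C\<^sub>n L\<^sub>d L\<^sub>u L\<^sub>f R \<epsilon> \<delta> =
    1 + ln C\<^sub>n + ln (L\<^sub>u / L\<^sub>d) + ln (1 + L\<^sub>f * R\<^sup>2 / \<epsilon>) + ln (1 / \<delta>)"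

text \<open>
  An admissible constant for the \<open>O\<close> of the bound. It is given explicitly because a
  constant that is existentially quantified for each type of vectors could depend on the dimension.
  \<open>C\<close> is the constant of the rate of the inner method, and \<open>\<kappa>\<close> bounds \<open>\<epsilon> / (L\<^sub>d R\<^sup>2)\<close>: the outer
  iteration that reaches the accuracy \<open>\<epsilon>\<close> may alone take of the order of \<open>C\<^sub>n L\<^sub>f / L\<^sub>d\<close> inner
  iterations, whatever \<open>\<epsilon>\<close> is, so the constant is uniform only for \<open>\<epsilon> = O(L\<^sub>d R\<^sup>2)\<close>.
\<close>

definition bound_const :: "real \<Rightarrow> real \<Rightarrow> real \<Rightarrow> real \<Rightarrow> real" where
  "bound_const \<alpha> \<beta> C \<kappa> = 1000 * (1 + C) * \<alpha> * (\<beta> / (\<beta> - 1))\<^sup>2 * (1 + sqrt \<kappa>)"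

end

theory Submission
  imports Defs
begin

text \<open>
  With \<open>E\<^sub>k = A\<^sub>k (f(y\<^sup>k) - f(x\<^sub>*)) + \<bar>z\<^sup>k - x\<^sub>*\<bar>\<^sup>2 / 2\<close>, the stopping criterion of the inner runs
  makes \<open>E\<^sub>k\<close> non-increasing, so \<open>A\<^sub>k \<ge> R\<^sup>2 / (2 \<epsilon>)\<close> suffices, and \<open>sqrt A\<^sub>k\<close> grows by at
  least \<open>1 / (2 sqrt L\<^sub>k)\<close> per outer iteration. With high probability an inner run with parameter
  \<open>L\<close> takes \<open>O(C\<^sub>n (1 + L\<^sub>f / L))\<close> iterations up to logarithms. Within one outer iteration these costs
  form a geometric series dominated by the last pass, and the number of passes telescopes through
  \<open>ln L\<^sub>k\<close>. So an outer iteration costs \<open>O(1 + L\<^sub>f / L\<^sub>k)\<close>, which is at most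
  \<open>sqrt L\<^sub>u + L\<^sub>f / sqrt L\<^sub>d\<close> times the growth \<open>1 / sqrt L\<^sub>k\<close> of \<open>sqrt A\<^sub>k\<close>. For a randomized
  method, the failure probability \<open>\<delta>\<close> is shared among the slots \<open>(k, r)\<close> of inner runs; the
  parameters of the run in a slot do not depend on the seed of that slot, so that seed can be resampled.
\<close>

section \<open>Auxiliary problems\<close>

text \<open>The length of an inner run does not depend on how far its starting point
  \<open>x\<close> is from the minimizer \<open>ystar\<close> of the auxiliary function: the
  accuracy that the stopping criterion asks for and the rate of the method both scale with
  \<open>(norm (x - ystar))\<^sup>2\<close>, so only the condition number
  \<open>(L\<^sub>f + L) / L\<close> remains. There is a circle to break. The share of the failure
  probability given to a slot \<open>(k, r)\<close> shrinks with \<open>k\<close> and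
  \<open>r\<close>, and its logarithm enters the length of the run, so a bound on \<open>k\<close>
  is needed before any work is estimated. It is available because \<open>sqrt A\<close> grows by at
  least \<open>1 / (2 * sqrt L\<^sub>u)\<close> per outer iteration and stays below the square root
  of the threshold until the end; and \<open>r\<close> is at most logarithmic in
  \<open>L\<^sub>u / L\<^sub>d\<close>. The last step may overshoot the threshold, by at most
  \<open>1 / sqrt L\<^sub>d\<close> on the scale of \<open>sqrt A\<close>; this is where \<kappa>
  enters. Runs are relations rather than functions, so the measurability of events about them takes
  a separate argument.\<close>

lemma grad_eqI:
  assumes "GDERIV f x :> D"
  shows "grad f x = D"
  unfolding grad_def
proof (rule the_equality)
  show "GDERIV f x :> D" by fact
next
  fix E assume "GDERIV f x :> E"
  then have "(\<lambda>h. inner h E) = (\<lambda>h. inner h D)"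
    using assms unfolding gderiv_def by (rule has_derivative_unique)
  then show "E = D"
    by (metis vector_eq_ldot)
qed

lemma smooth_fun_GDERIV: "smooth_fun L f \<Longrightarrow> GDERIV f x :> grad f x"
  unfolding smooth_fun_def using grad_eqI by metis

lemma GDERIV_aux_fun:
  assumes "GDERIV f y :> D"
  shows "GDERIV (aux_fun f L x) y :> D + L *\<^sub>R (y - x)"
proof -
  have "aux_fun f L x = (\<lambda>y. f y + L / 2 * (inner (y - x) (y - x)))"
    by (simp add: aux_fun_def fun_eq_iff power2_norm_eq_inner)
  moreover have "GDERIV (\<lambda>y. f y + L / 2 * (inner (y - x) (y - x))) y :> D + L *\<^sub>R (y - x)"
    using assms unfolding gderiv_def
    by (auto intro!: derivative_eq_intros simp: inner_right_distrib inner_commute fun_eq_iff)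
  ultimately show ?thesis by simp
qed

lemma grad_aux_fun:
  assumes "smooth_fun K f"
  shows "grad (aux_fun f L x) y = grad f y + L *\<^sub>R (y - x)"
  by (rule grad_eqI[OF GDERIV_aux_fun[OF smooth_fun_GDERIV[OF assms]]])

lemma continuous_smooth_fun:
  assumes "smooth_fun K f"
  shows "continuous_on A f"
  by (meson assms continuous_at_imp_continuous_on gderiv_def has_derivative_continuous
      smooth_fun_GDERIV)

text \<open>Restricting \<open>f\<close> to the line through \<open>x\<close> and \<open>y\<close>
  reduces this to the tangent inequality for a convex function of one real variable, between the
  arguments 0 and 1.\<close>

lemma convex_on_above_gradient:
  fixes f :: "'a::real_inner \<Rightarrow> real"
  assumes "convex_on UNIV f" and "GDERIV f x :> D"
  shows "f x + inner D (y - x) \<le> f y"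
proof -
  define g where "g t = f (x + t *\<^sub>R (y - x))" for t
  have "convex_on UNIV g"
  proof (rule convex_onI)
    fix t a b :: real assume t: "0 < t" "t < 1"
    have "x + ((1 - t) *\<^sub>R a + t *\<^sub>R b) *\<^sub>R (y - x)
        = (1 - t) *\<^sub>R (x + a *\<^sub>R (y - x)) + t *\<^sub>R (x + b *\<^sub>R (y - x))"
      by (simp add: algebra_simps)
    then show "g ((1 - t) *\<^sub>R a + t *\<^sub>R b) \<le> (1 - t) * g a + t * g b"
      unfolding g_def using convex_onD[OF assms(1), of t] t by simp
  qed simp
  moreover have "(g has_real_derivative inner D (y - x)) (at 0)"
  proof -
    have "(g has_derivative (\<lambda>h. inner (h *\<^sub>R (y - x)) D)) (at 0)"
      unfolding g_def
      by (rule has_derivative_compose[where g = f and f = "\<lambda>t. x + t *\<^sub>R (y - x)"])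
        (auto intro!: derivative_eq_intros simp: assms(2)[unfolded gderiv_def])
    moreover have "(\<lambda>h. inner (h *\<^sub>R (y - x)) D) = (*) (inner D (y - x))"
      by (simp add: fun_eq_iff inner_commute mult.commute)
    ultimately show ?thesis by (simp add: has_field_derivative_def)
  qed
  ultimately have "g 1 - g 0 \<ge> inner D (y - x) * (1 - 0)"
    by (intro convex_on_imp_above_tangent[where A = UNIV]) auto
  then show ?thesis by (simp add: g_def)
qed

text \<open>The radius \<open>r\<close> solves \<open>L / 2 * r\<^sup>2 = f x - m\<close>. Beyond it
  the quadratic term alone outweighs anything \<open>f\<close> can gain over \<open>f x\<close>, so
  a minimizer on the compact ball is global.\<close>

lemma ex_minimizer_aux_fun:
  fixes f :: "'a::euclidean_space \<Rightarrow> real"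
  assumes "continuous_on UNIV f" and bound: "\<And>y. m \<le> f y" and "0 < L"
  shows "\<exists>ystar. \<forall>y. aux_fun f L x ystar \<le> aux_fun f L x y"
proof -
  define F where "F = aux_fun f L x"
  define r where "r = sqrt (2 / L * (f x - m))"
  have "continuous_on (cball x r) F"
    unfolding F_def aux_fun_def
    by (intro continuous_intros continuous_on_subset[OF assms(1)]) auto
  moreover have "0 \<le> r" using bound[of x] \<open>0 < L\<close> by (simp add: r_def)
  ultimately obtain ystar where ystar: "\<And>y. y \<in> cball x r \<Longrightarrow> F ystar \<le> F y"
    using continuous_attains_inf[OF compact_cball, of x r F]
    by (metis cball_eq_empty linorder_not_less)
  have "F ystar \<le> F y" for y
  proof (cases "y \<in> cball x r")
    case False
    have "r\<^sup>2 \<le> (norm (y - x))\<^sup>2"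
      using False \<open>0 \<le> r\<close> by (intro power_mono) (auto simp: dist_norm norm_minus_commute)
    then have "2 / L * (f x - m) \<le> (norm (y - x))\<^sup>2"
      using bound[of x] \<open>0 < L\<close> by (simp add: r_def)
    then have "f x - m \<le> L / 2 * (norm (y - x))\<^sup>2"
      using \<open>0 < L\<close> by (simp add: field_simps)
    then have "F x \<le> F y"
      using bound[of y] by (simp add: F_def aux_fun_def)
    then show ?thesis using ystar[of x] \<open>0 \<le> r\<close> by simp
  qed (use ystar in simp)
  then show ?thesis unfolding F_def by blast
qed

text \<open>At the minimizer \<open>grad f ystar = L *\<^sub>R (x - ystar)\<close>. Expanding
  \<open>norm (y - x)\<close> around \<open>ystar\<close> produces a cross term that cancels against
  the linear term of the tangent inequality of \<open>f\<close>, which leaves the quadratic.\<close>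

lemma aux_fun_quadratic_growth:
  fixes f :: "'a::euclidean_space \<Rightarrow> real"
  assumes "convex_on UNIV f" and "smooth_fun K f"
    and min: "\<And>y. aux_fun f L x ystar \<le> aux_fun f L x y"
  shows "grad (aux_fun f L x) ystar = 0"
    and "L / 2 * (norm (y - ystar))\<^sup>2 \<le> aux_fun f L x y - aux_fun f L x ystar"
proof -
  let ?D = "grad f ystar + L *\<^sub>R (ystar - x)"
  have "(aux_fun f L x has_derivative (\<lambda>h. inner h ?D)) (at ystar)"
    using GDERIV_aux_fun[OF smooth_fun_GDERIV[OF assms(2)]] by (simp add: gderiv_def)
  from differential_zero_maxmin[OF _ _ this, of UNIV] min
  have D: "?D = 0" by (metis UNIV_I inner_eq_zero_iff open_UNIV)
  then show "grad (aux_fun f L x) ystar = 0"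
    by (simp add: grad_aux_fun[OF assms(2)])
  have g: "grad f ystar = L *\<^sub>R (x - ystar)"
    using D by (simp add: algebra_simps add_eq_0_iff2)
  have "f ystar + inner (L *\<^sub>R (x - ystar)) (y - ystar) \<le> f y"
    using convex_on_above_gradient[OF assms(1) smooth_fun_GDERIV[OF assms(2)], of ystar y]
    by (simp add: g)
  moreover have "(norm (y - x))\<^sup>2 = (norm (y - ystar))\<^sup>2 + (norm (ystar - x))\<^sup>2
      - 2 * inner (x - ystar) (y - ystar)"
    by (simp add: power2_norm_eq_inner algebra_simps inner_commute)
  then have "L / 2 * (norm (y - x))\<^sup>2 = L / 2 * (norm (y - ystar))\<^sup>2 + L / 2 * (norm (ystar - x))\<^sup>2
      - L * inner (x - ystar) (y - ystar)"
    by (simp only: distrib_left right_diff_distrib)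
  ultimately show "L / 2 * (norm (y - ystar))\<^sup>2 \<le> aux_fun f L x y - aux_fun f L x ystar"
    unfolding aux_fun_def inner_scaleR_left by linarith
qed

text \<open>Quadratic growth turns the small gap into
  \<open>3 * (K + L) * norm (y - ystar) \<le> L * norm (x - ystar)\<close>. Then the gradient at
  \<open>y\<close>, which vanishes at \<open>ystar\<close>, is small, while \<open>y\<close> is
  still far from \<open>x\<close>. The constant 18 is the square of 3 times the 2 that undoes the
  factor 1/2 in the growth bound.\<close>

lemma stop_crit_of_small_gap:
  fixes f :: "'a::euclidean_space \<Rightarrow> real"
  assumes "convex_on UNIV f" and "smooth_fun K f" and "0 < L"
    and min: "\<And>y. aux_fun f L x ystar \<le> aux_fun f L x y"
    and gap: "18 * (K + L)\<^sup>2 * (aux_fun f L x y - aux_fun f L x ystar) \<le> L ^ 3 * (norm (x - ystar))\<^sup>2"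
  shows "stop_crit f L x y"
proof -
  let ?e = "norm (y - ystar)" and ?R = "norm (x - ystar)"
  have K: "K-lipschitz_on UNIV (grad f)" using assms(2) by (simp add: smooth_fun_def)
  have K0: "0 \<le> K" using K by (rule lipschitz_on_nonneg)
  note quad = aux_fun_quadratic_growth[OF assms(1,2) min]
  have "(3 * (K + L) * ?e)\<^sup>2 = 9 * (K + L)\<^sup>2 * ?e\<^sup>2"
    by (simp only: power_mult_distrib) simp
  also have "\<dots> = 18 * (K + L)\<^sup>2 / L * (L / 2 * ?e\<^sup>2)"
    using \<open>0 < L\<close> by simp
  also have "\<dots> \<le> 18 * (K + L)\<^sup>2 / L * (aux_fun f L x y - aux_fun f L x ystar)"
    using \<open>0 < L\<close> by (intro mult_left_mono quad(2)) auto
  also have "\<dots> \<le> L ^ 3 * ?R\<^sup>2 / L"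
    using gap \<open>0 < L\<close> by (simp add: divide_right_mono)
  also have "\<dots> = (L * ?R)\<^sup>2"
    using \<open>0 < L\<close> by (simp add: power2_eq_square power3_eq_cube)
  finally have small: "3 * (K + L) * ?e \<le> L * ?R"
    using \<open>0 < L\<close> by (meson mult_nonneg_nonneg norm_ge_zero less_imp_le power2_le_imp_le)
  have "grad (aux_fun f L x) y = (grad f y - grad f ystar) + L *\<^sub>R (y - ystar)"
    using quad(1) by (simp add: grad_aux_fun[OF assms(2)] algebra_simps add_eq_0_iff2)
  then have "norm (grad (aux_fun f L x) y) \<le> norm (grad f y - grad f ystar) + L * ?e"
    using \<open>0 < L\<close> norm_triangle_ineq[of "grad f y - grad f ystar" "L *\<^sub>R (y - ystar)"] by simp
  also have "norm (grad f y - grad f ystar) \<le> K * ?e"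
    using lipschitz_on_normD[OF K, of y ystar] by simp
  finally have "norm (grad (aux_fun f L x) y) \<le> (K + L) * ?e"
    by (simp add: algebra_simps)
  \<comment> \<open>By \<open>small\<close> the right-hand side is at least
    \<open>(3 / 2 * K + L) * ?e\<close>; the factor 3 is chosen to leave this after the loss of
    \<open>L / 2 * ?e\<close>.\<close>
  also have "\<dots> \<le> L / 2 * (?R - ?e)"
  proof -
    have "0 \<le> K * ?e" using K0 by simp
    then show ?thesis using small by (simp add: algebra_simps)
  qed
  also have "\<dots> \<le> L / 2 * norm (y - x)"
    using \<open>0 < L\<close> norm_triangle_ineq2[of "x - ystar" "y - ystar"]
    by (intro mult_left_mono) (auto simp: norm_minus_commute)
  finally show ?thesis by (simp add: stop_crit_def)
qed

text \<open>Half of the exponent absorbs the linear factor, which arises when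
  \<open>ln (t / \<delta>)\<close> is bounded by \<open>t / \<delta>\<close>. The inequality
  \<open>u \<le> exp (u / 2)\<close> is the product of two instances of
  \<open>1 + v \<le> exp v\<close>, at \<open>u / 2 - 1\<close> and at 1.\<close>

lemma mult_exp_minus_le:
  fixes u :: real
  assumes "0 \<le> u"
  shows "u * exp (- u) \<le> exp (- (u / 2))"
proof -
  have "u \<le> exp (u / 2)"
  proof -
    have "u / 2 * 2 \<le> exp (u / 2 - 1) * exp 1"
      using exp_ge_add_one_self[of "u / 2 - 1"] exp_ge_add_one_self[of 1] assms
      by (intro mult_mono) auto
    then show ?thesis by (simp flip: exp_add)
  qed
  then have "u * exp (- u) \<le> exp (u / 2) * exp (- u)" by simp
  also have "\<dots> = exp (- (u / 2))" by (simp flip: exp_add)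
  finally show ?thesis .
qed

text \<open>With the condition number \<open>q = (K + L) / L\<close>, the leading 2 pays for the
  halved exponent. Under the logarithm, three powers of \<open>q\<close> come from the accuracy
  required by the stopping criterion, and \<open>q * C\<^sub>n\<close> from measuring time in units
  of \<open>C\<^sub>n * q\<close>.\<close>

definition work_bound :: "real \<Rightarrow> real \<Rightarrow> real \<Rightarrow> real \<Rightarrow> real \<Rightarrow> real" where
  "work_bound C C\<^sub>n K L \<delta> =
    2 * C\<^sub>n * ((K + L) / L) * ln (18 * (1 + C) * ((K + L) / L) ^ 4 * C\<^sub>n / \<delta>)"

text \<open>Termination of the inner run is part of the notion, not only the bound on its length.
  The added 1 pays for rounding \<open>work_bound\<close> up to a natural number.\<close>

definition good_seed ::
  "('a::real_inner \<Rightarrow> real) \<Rightarrow> ('a, 's) inner_method \<Rightarrow> real \<Rightarrow> real \<Rightarrow> real \<Rightarrow> real \<Rightarrow> 'a \<Rightarrow> 's \<Rightarrow> real \<Rightarrow> bool"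
where
  "good_seed f M C C\<^sub>n K L x s \<delta> \<longleftrightarrow>
    (\<exists>n. inner_run f M L x s n (M (aux_fun f L x) x s n) \<and> real n \<le> work_bound C C\<^sub>n K L \<delta> + 1)"

lemma inner_run_of_stop_crit:
  assumes "1 \<le> t" and "stop_crit f L x (M (aux_fun f L x) x s t)"
  shows "\<exists>n\<le>t. inner_run f M L x s n (M (aux_fun f L x) x s n)"
proof -
  let ?P = "\<lambda>t. 1 \<le> t \<and> stop_crit f L x (M (aux_fun f L x) x s t)"
  have "?P t" using assms by simp
  then have "?P (LEAST t. ?P t)" and "(LEAST t. ?P t) \<le> t"
    by (rule LeastI, rule Least_le)
  then show ?thesis
    unfolding inner_run_def using not_less_Least[of _ ?P] by blast
qed

lemma work_bound_pos:
  assumes "0 \<le> K" and "0 < L" and "0 < C" and "1 \<le> C\<^sub>n" and "0 < \<delta>" and "\<delta> \<le> 1"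
  shows "0 < work_bound C C\<^sub>n K L \<delta>"
proof -
  have q: "1 \<le> (K + L) / L" using assms by simp
  have "18 * 1 * 1 * 1 / 1 \<le> 18 * (1 + C) * ((K + L) / L) ^ 4 * C\<^sub>n / \<delta>"
    using assms q by (intro frac_le mult_mono one_le_power) auto
  then have "1 < 18 * (1 + C) * ((K + L) / L) ^ 4 * C\<^sub>n / \<delta>" by linarith
  then show ?thesis
    unfolding work_bound_def using assms q by (intro mult_pos_pos ln_gt_zero) auto
qed

text \<open>One time \<open>t\<close> is enough: if the rate holds there, the criterion is met at
  \<open>t\<close> and the run stops no later. The exponential branch of the minimum is used, and
  \<open>(norm (x - ystar))\<^sup>2\<close> stands on both sides of the comparison.\<close>

lemma good_seed_of_rate:
  fixes f :: "'a::euclidean_space \<Rightarrow> real"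
  assumes cvx: "convex_on UNIV f" and sm: "smooth_fun K f" and "0 < L"
    and min: "\<And>y. aux_fun f L x ystar \<le> aux_fun f L x y"
    and C: "0 < C" and Cn: "1 \<le> C\<^sub>n" and \<delta>: "0 < \<delta>" "\<delta> \<le> 1 / 4"
  defines "t \<equiv> nat \<lceil>work_bound C C\<^sub>n K L \<delta>\<rceil>"
  assumes rate: "aux_fun f L x (M (aux_fun f L x) x s t) - aux_fun f L x ystar
        \<le> C * (K + L) * (norm (x - ystar))\<^sup>2 * ln (real t / \<delta>) * rate C\<^sub>n L (K + L) t"
  shows "good_seed f M C C\<^sub>n K L x s \<delta>"
proof -
  have K0: "0 \<le> K" using sm unfolding smooth_fun_def by (auto intro: lipschitz_on_nonneg)
  define q where "q = (K + L) / L"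
  have q: "1 \<le> q" using K0 \<open>0 < L\<close> by (simp add: q_def)
  define B where "B = 18 * (1 + C) * q ^ 4 * C\<^sub>n / \<delta>"
  have Bpos: "0 < B" using C q Cn \<delta> unfolding B_def by (intro divide_pos_pos mult_pos_pos) auto
  have wb: "work_bound C C\<^sub>n K L \<delta> = 2 * C\<^sub>n * q * ln B"
    by (simp add: work_bound_def q_def B_def)
  have pos: "0 < 2 * C\<^sub>n * q * ln B"
    using work_bound_pos[OF K0 \<open>0 < L\<close> C Cn \<delta>(1)] \<delta>(2) by (simp add: wb)
  then have t1: "1 \<le> t" unfolding t_def wb by linarith
  have t_ge: "2 * C\<^sub>n * q * ln B \<le> real t" unfolding t_def wb by linarith
  have t_le: "real t \<le> 2 * C\<^sub>n * q * ln B + 1" unfolding t_def wb using pos by linarith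
  define u where "u = real t / (C\<^sub>n * q)"
  have u0: "0 \<le> u" using Cn q by (simp add: u_def)
  have u: "2 * ln B \<le> u" using t_ge Cn q by (simp add: u_def field_simps)
  have "L * real t / (C\<^sub>n * (K + L)) = u"
    using \<open>0 < L\<close> K0 by (simp add: u_def q_def)
  then have r: "rate C\<^sub>n L (K + L) t \<le> exp (- u)" by (simp add: rate_def)
  have "1 \<le> real t / \<delta>" using t1 \<delta> by (simp add: field_simps)
  then have ln0: "0 \<le> ln (real t / \<delta>)" and ln_le: "ln (real t / \<delta>) \<le> real t / \<delta>"
    using ln_le_minus_one[of "real t / \<delta>"] by simp_all
  \<comment> \<open>The chain ends at 1 because \<open>u \<ge> 2 * ln B\<close>: once the factor
    \<open>u\<close> is absorbed, \<open>exp (- (u / 2))\<close> cancels \<open>B\<close>.\<close>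
  have "18 * C * q ^ 3 * (ln (real t / \<delta>) * rate C\<^sub>n L (K + L) t)
      \<le> 18 * (1 + C) * q ^ 3 * ((real t / \<delta>) * exp (- u))"
  proof (intro mult_mono ln_le r)
    show "0 \<le> rate C\<^sub>n L (K + L) t" using Cn by (simp add: rate_def)
    then show "0 \<le> ln (real t / \<delta>) * rate C\<^sub>n L (K + L) t" using ln0 by simp
  qed (use C q \<delta> in auto)
  also have "\<dots> = B * (u * exp (- u))"
    using Cn q \<delta> by (simp add: u_def B_def field_simps power3_eq_cube power4_eq_xxxx)
  also have "\<dots> \<le> B * exp (- (u / 2))"
    using Bpos u0 by (intro mult_left_mono mult_exp_minus_le) auto
  also have "\<dots> \<le> B * exp (- ln B)"
    using Bpos u by simp
  also have "\<dots> = 1" using Bpos by (simp add: exp_minus)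
  finally have key: "18 * C * q ^ 3 * (ln (real t / \<delta>) * rate C\<^sub>n L (K + L) t) \<le> 1" .
  have "18 * (K + L)\<^sup>2 * (aux_fun f L x (M (aux_fun f L x) x s t) - aux_fun f L x ystar)
      \<le> 18 * (K + L)\<^sup>2 * (C * (K + L) * (norm (x - ystar))\<^sup>2 * ln (real t / \<delta>) * rate C\<^sub>n L (K + L) t)"
    by (intro mult_left_mono rate) simp
  also have "\<dots> = L ^ 3 * (norm (x - ystar))\<^sup>2 * (18 * C * q ^ 3 * (ln (real t / \<delta>) * rate C\<^sub>n L (K + L) t))"
    using \<open>0 < L\<close> by (simp add: q_def power_divide power2_eq_square power3_eq_cube mult_ac)
  also have "\<dots> \<le> L ^ 3 * (norm (x - ystar))\<^sup>2 * 1"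
    using \<open>0 < L\<close> key by (intro mult_left_mono) auto
  finally have "stop_crit f L x (M (aux_fun f L x) x s t)"
    using stop_crit_of_small_gap[OF cvx sm \<open>0 < L\<close> min] by simp
  from inner_run_of_stop_crit[where M = M, OF t1 this] show "good_seed f M C C\<^sub>n K L x s \<delta>"
    unfolding good_seed_def wb using t_le by force
qed

section \<open>The energy estimate\<close>

lemma step_a_pos: "0 < L \<Longrightarrow> 0 \<le> A \<Longrightarrow> 0 < step_a A L"
  unfolding step_a_def by (simp add: add_pos_nonneg)

text \<open>\<open>step_a A L\<close> comes from the quadratic formula. The identity turns the
  coefficient \<open>L * a\<^sup>2\<close> of the energy estimate into the new value of
  \<open>A\<close>.\<close>

lemma step_a_root:
  assumes "0 < L" "0 \<le> A"
  shows "L * (step_a A L)\<^sup>2 = A + step_a A L"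
proof -
  define s where "s = sqrt (1 / L\<^sup>2 + 4 * A / L)"
  have s2: "s\<^sup>2 = 1 / L\<^sup>2 + 4 * A / L" using assms by (simp add: s_def)
  have "(step_a A L)\<^sup>2 = (1 / L\<^sup>2 + 2 * s / L + s\<^sup>2) / 4"
    using assms unfolding step_a_def s_def[symmetric] by (simp add: power2_eq_square field_simps)
  then have "L * (step_a A L)\<^sup>2 = L * ((1 / L\<^sup>2 + 2 * s / L + (1 / L\<^sup>2 + 4 * A / L)) / 4)"
    using s2 by simp
  also have "\<dots> = A + (1 / L + s) / 2"
    using assms by (simp add: field_simps power2_eq_square)
  finally show ?thesis by (simp add: step_a_def s_def)
qed

text \<open>The root identity gives \<open>sqrt (A + a) = sqrt L * a\<close>, which has a closed
  form; the two bounds then drop a term under the root and use subadditivity of the root. The first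
  bound drives the convergence, the second limits the overshoot of the last step.\<close>

lemma sqrt_step_a:
  assumes "0 < L" "0 \<le> A"
  shows "sqrt A + 1 / (2 * sqrt L) \<le> sqrt (A + step_a A L)"
    and "sqrt (A + step_a A L) \<le> sqrt A + 1 / sqrt L"
proof -
  have "sqrt (A + step_a A L) = sqrt L * step_a A L"
    using step_a_pos[OF assms]
    by (simp flip: step_a_root[OF assms] add: real_sqrt_mult)
  also have "\<dots> = (1 / sqrt L + sqrt L * sqrt (1 / L\<^sup>2 + 4 * A / L)) / 2"
  proof -
    have "sqrt L / L = 1 / sqrt L"
      using assms by (simp add: real_div_sqrt field_simps)
    then show ?thesis by (simp add: step_a_def distrib_left)
  qed
  also have "sqrt L * sqrt (1 / L\<^sup>2 + 4 * A / L) = sqrt (1 / L + 4 * A)"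
    using assms by (simp add: field_simps power2_eq_square flip: real_sqrt_mult)
  finally have eq: "sqrt (A + step_a A L) = (1 / sqrt L + sqrt (1 / L + 4 * A)) / 2" .
  have "sqrt (4 * A) \<le> sqrt (1 / L + 4 * A)" using assms by simp
  then show "sqrt A + 1 / (2 * sqrt L) \<le> sqrt (A + step_a A L)"
    unfolding eq by (simp add: real_sqrt_mult)
  have "sqrt (1 / L + 4 * A) \<le> sqrt (1 / L) + sqrt (4 * A)"
    using assms by (intro sqrt_add_le_add_sqrt) auto
  then show "sqrt (A + step_a A L) \<le> sqrt A + 1 / sqrt L"
    unfolding eq by (simp add: real_sqrt_mult real_sqrt_divide)
qed

text \<open>
  The stopping criterion is used only through \<open>\<bar>g\<bar>\<^sup>2 + 2 L \<langle>g, y' - x\<rangle> \<le> 0\<close>, where \<open>g\<close> is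
  the gradient of \<open>f\<close> at \<open>y'\<close>.
\<close>

lemma energy_decreases:
  fixes f :: "'a::euclidean_space \<Rightarrow> real"
  assumes cvx: "convex_on UNIV f" and sm: "smooth_fun K f" and L: "0 < L" and A: "0 \<le> A"
    and stop: "stop_crit f L (step_x A y z L) y'"
  shows "(A + step_a A L) * (f y' - f w) + (norm (z - step_a A L *\<^sub>R grad f y' - w))\<^sup>2 / 2
    \<le> A * (f y - f w) + (norm (z - w))\<^sup>2 / 2"
proof -
  define a where "a = step_a A L"
  define x where "x = step_x A y z L"
  define g where "g = grad f y'"
  have a: "0 < a" using step_a_pos[OF L A] by (simp add: a_def)
  have root: "L * a\<^sup>2 = A + a" using step_a_root[OF L A] by (simp add: a_def)
  have "(A + a) *\<^sub>R x = A *\<^sub>R y + a *\<^sub>R z"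
    using a A by (simp add: x_def step_x_def a_def[symmetric] scaleR_right_distrib)
  then have comb: "(A + a) * inner g x = A * inner g y + a * inner g z"
    by (metis inner_add_right inner_scaleR_right)
  have tangent: "f y' + inner g (u - y') \<le> f u" for u
    using convex_on_above_gradient[OF cvx smooth_fun_GDERIV[OF sm]] by (simp add: g_def)
  have "norm (g + L *\<^sub>R (y' - x)) \<le> L / 2 * norm (y' - x)"
    using stop by (simp add: stop_crit_def grad_aux_fun[OF sm] g_def x_def)
  also have "\<dots> \<le> norm (L *\<^sub>R (y' - x))" using L by simp
  finally have "(norm (g + L *\<^sub>R (y' - x)))\<^sup>2 \<le> (norm (L *\<^sub>R (y' - x)))\<^sup>2"
    by (intro power_mono) auto
  then have "inner g g + 2 * L * inner g (y' - x) \<le> 0"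
    unfolding power2_norm_eq_inner
    by (simp add: inner_add_left inner_add_right inner_commute)
  then have "a\<^sup>2 / 2 * (inner g g + 2 * L * inner g (y' - x)) \<le> 0"
    by (simp add: mult_nonneg_nonpos)
  moreover have "a\<^sup>2 / 2 * (inner g g + 2 * L * inner g (y' - x))
      = a\<^sup>2 / 2 * inner g g + L * a\<^sup>2 * inner g (y' - x)"
    by (simp add: algebra_simps)
  ultimately have crit: "a\<^sup>2 / 2 * inner g g + (A + a) * inner g (y' - x) \<le> 0"
    by (simp add: root)
  \<comment> \<open>Convexity is used at \<open>w\<close> and at \<open>y\<close>, with weights
    \<open>a\<close> and \<open>A\<close>. Together with \<open>- a * inner g (z - w)\<close> from
    the expanded norm, the linear terms add up to \<open>(A + a) * inner g (y' - x)\<close> by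
    \<open>comb\<close>, which \<open>crit\<close> controls.\<close>
  have "a * (f y' + inner g (w - y')) + A * (f y' + inner g (y - y')) \<le> a * f w + A * f y"
    using a A by (intro add_mono mult_left_mono tangent) auto
  moreover have "(norm (z - a *\<^sub>R g - w))\<^sup>2 / 2
      = (norm (z - w))\<^sup>2 / 2 - a * inner g (z - w) + a\<^sup>2 / 2 * inner g g"
  proof -
    have "z - a *\<^sub>R g - w = (z - w) - a *\<^sub>R g" by simp
    then show ?thesis
      by (simp only: power2_norm_eq_inner inner_diff_left inner_diff_right inner_scaleR_left
          inner_scaleR_right)
        (simp add: inner_commute power2_eq_square field_simps)
  qed
  ultimately show ?thesis
    using crit comb unfolding a_def[symmetric] g_def[symmetric]
    by (simp add: inner_diff_right algebra_simps)
qed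

section \<open>Determinacy of runs\<close>

lemma inner_run_unique:
  assumes "inner_run f M L x s n y" "inner_run f M L x s n' y'"
  shows "n = n' \<and> y = y'"
  using assms unfolding inner_run_def by (metis linorder_neqE_nat)

lemma passes_inner_run:
  "passes f M \<beta> \<gamma> L\<^sub>d Linit A y z \<sigma> r L n y' T b \<Longrightarrow> inner_run f M L (step_x A y z L) (\<sigma> r) n y'"
  by (induction rule: passes.induct) auto

lemma passes_ge_1: "passes f M \<beta> \<gamma> L\<^sub>d Linit A y z \<sigma> r L n y' T b \<Longrightarrow> 1 \<le> r"
  by (induction rule: passes.induct) auto

text \<open>An inversion rule in which one pass is peeled off, suited to induction on
  \<open>r\<close>. For \<open>r = 0\<close> the second disjunct is empty, as passes are numbered
  from 1.\<close>

lemma passes_Suc_iff: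
  "passes f M \<beta> \<gamma> L\<^sub>d Linit A y z \<sigma> (Suc r) L' n' y'' T' b \<longleftrightarrow>
    (r = 0 \<and> L' = max (Linit / \<beta>) L\<^sub>d \<and> inner_run f M L' (step_x A y z L') (\<sigma> 1) n' y''
      \<and> T' = n' \<and> b = (L' = L\<^sub>d)) \<or>
    (\<exists>L n y' T. passes f M \<beta> \<gamma> L\<^sub>d Linit A y z \<sigma> r L n y' T False \<and> L' = max (L / \<beta>) L\<^sub>d
      \<and> inner_run f M L' (step_x A y z L') (\<sigma> (Suc r)) n' y'' \<and> T' = T + n'
      \<and> b = (real n' \<ge> \<gamma> * real n \<or> L' = L\<^sub>d))"
  by (subst passes.simps) auto

lemma passes_unique:
  assumes "passes f M \<beta> \<gamma> L\<^sub>d Linit A y z \<sigma> r L n y' T b"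
    and "passes f M \<beta> \<gamma> L\<^sub>d Linit A y z \<sigma> r L2 n2 y2 T2 b2"
  shows "L = L2 \<and> n = n2 \<and> y' = y2 \<and> T = T2 \<and> b = b2"
  using assms
proof (induction r arbitrary: L n y' T b L2 n2 y2 T2 b2)
  case 0
  then show ?case using passes_ge_1 by fastforce
next
  case (Suc r)
  show ?case
  proof (cases "r = 0")
    case True
    have "\<not> passes f M \<beta> \<gamma> L\<^sub>d Linit A y z \<sigma> 0 L n y' T b" for L n y' T b
      using passes_ge_1 by fastforce
    then show ?thesis
      using Suc.prems inner_run_unique unfolding passes_Suc_iff True by metis
  next
    case False
    from Suc.prems(1) False obtain L1 n1 y1 T1 where
      1: "passes f M \<beta> \<gamma> L\<^sub>d Linit A y z \<sigma> r L1 n1 y1 T1 False" "L = max (L1 / \<beta>) L\<^sub>d"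
        "inner_run f M L (step_x A y z L) (\<sigma> (Suc r)) n y'" "T = T1 + n"
        "b = (real n \<ge> \<gamma> * real n1 \<or> L = L\<^sub>d)"
      unfolding passes_Suc_iff by blast
    from Suc.prems(2) False obtain L1' n1' y1' T1' where
      2: "passes f M \<beta> \<gamma> L\<^sub>d Linit A y z \<sigma> r L1' n1' y1' T1' False" "L2 = max (L1' / \<beta>) L\<^sub>d"
        "inner_run f M L2 (step_x A y z L2) (\<sigma> (Suc r)) n2 y2" "T2 = T1' + n2"
        "b2 = (real n2 \<ge> \<gamma> * real n1' \<or> L2 = L\<^sub>d)"
      unfolding passes_Suc_iff by blast
    have "L1 = L1' \<and> n1 = n1' \<and> T1 = T1'" using Suc.IH[OF 1(1) 2(1)] by simp
    then show ?thesis using 1 2 inner_run_unique by metis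
  qed
qed

lemma passes_earlier:
  assumes "passes f M \<beta> \<gamma> L\<^sub>d Linit A y z \<sigma> r L n y' T b" and "1 \<le> j" and "j < r"
  shows "\<exists>L n y' T. passes f M \<beta> \<gamma> L\<^sub>d Linit A y z \<sigma> j L n y' T False"
  using assms
proof (induction r arbitrary: L n y' T b)
  case (Suc r)
  then obtain L1 n1 y1 T1 where "passes f M \<beta> \<gamma> L\<^sub>d Linit A y z \<sigma> r L1 n1 y1 T1 False"
    unfolding passes_Suc_iff by auto
  then show ?case using Suc.IH Suc.prems(2,3) by (cases "j = r") auto
qed simp

text \<open>All passes before an exit carry the flag \<open>False\<close>, and the flag of a pass is
  determined by its index; hence two exits have the same index.\<close>

lemma passes_exit_unique:
  assumes "passes f M \<beta> \<gamma> L\<^sub>d Linit A y z \<sigma> r L n y' T True"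
    and "passes f M \<beta> \<gamma> L\<^sub>d Linit A y z \<sigma> r2 L2 n2 y2 T2 True"
  shows "L = L2 \<and> y' = y2 \<and> T = T2"
proof -
  have "\<not> r < r2" "\<not> r2 < r"
    using assms passes_earlier passes_unique passes_ge_1 by metis+
  then have "r = r2" by simp
  then show ?thesis using assms passes_unique by metis
qed

lemma passes_cong_seed:
  assumes "passes f M \<beta> \<gamma> L\<^sub>d Linit A y z \<sigma> r L n y' T b" and "\<And>j. j \<le> r \<Longrightarrow> \<sigma> j = \<sigma>' j"
  shows "passes f M \<beta> \<gamma> L\<^sub>d Linit A y z \<sigma>' r L n y' T b"
  using assms
proof (induction rule: passes.induct)
  case (first L n y')
  then show ?case by (intro passes.first) auto
next
  case (again r L n y' T L' n' y'')
  then show ?case by (intro passes.again) auto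
qed

lemma catalyst_0_iff:
  "catalyst f M \<alpha> \<beta> \<gamma> L\<^sub>d L\<^sub>u L0 x0 \<omega> 0 L A y z T \<longleftrightarrow> L = L0 \<and> A = 0 \<and> y = x0 \<and> z = x0 \<and> T = 0"
  by (subst catalyst.simps) auto

lemma catalyst_Suc_iff:
  "catalyst f M \<alpha> \<beta> \<gamma> L\<^sub>d L\<^sub>u L0 x0 \<omega> (Suc k) L' A' y' z' T' \<longleftrightarrow>
    (\<exists>L A y z T r n T1. catalyst f M \<alpha> \<beta> \<gamma> L\<^sub>d L\<^sub>u L0 x0 \<omega> k L A y z T \<and>
      passes f M \<beta> \<gamma> L\<^sub>d (\<beta> * min (\<alpha> * L) L\<^sub>u) A y z (\<lambda>r. \<omega> (k, r)) r L' n y' T1 True \<and>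
      A' = A + step_a A L' \<and> z' = z - step_a A L' *\<^sub>R grad f y' \<and> T' = T + T1)"
proof
  assume "catalyst f M \<alpha> \<beta> \<gamma> L\<^sub>d L\<^sub>u L0 x0 \<omega> (Suc k) L' A' y' z' T'"
  then show "\<exists>L A y z T r n T1. catalyst f M \<alpha> \<beta> \<gamma> L\<^sub>d L\<^sub>u L0 x0 \<omega> k L A y z T \<and>
      passes f M \<beta> \<gamma> L\<^sub>d (\<beta> * min (\<alpha> * L) L\<^sub>u) A y z (\<lambda>r. \<omega> (k, r)) r L' n y' T1 True \<and>
      A' = A + step_a A L' \<and> z' = z - step_a A L' *\<^sub>R grad f y' \<and> T' = T + T1"
    by cases blast
qed (auto intro: catalyst.step)

lemma catalyst_unique:
  assumes "catalyst f M \<alpha> \<beta> \<gamma> L\<^sub>d L\<^sub>u L0 x0 \<omega> k L A y z T"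
    and "catalyst f M \<alpha> \<beta> \<gamma> L\<^sub>d L\<^sub>u L0 x0 \<omega> k L2 A2 y2 z2 T2"
  shows "L = L2 \<and> A = A2 \<and> y = y2 \<and> z = z2 \<and> T = T2"
  using assms
proof (induction k arbitrary: L A y z T L2 A2 y2 z2 T2)
  case 0
  then show ?case by (simp add: catalyst_0_iff)
next
  case (Suc k)
  from Suc.prems(1) obtain L' A' y' z' T' r n T1 where
    1: "catalyst f M \<alpha> \<beta> \<gamma> L\<^sub>d L\<^sub>u L0 x0 \<omega> k L' A' y' z' T'"
      "passes f M \<beta> \<gamma> L\<^sub>d (\<beta> * min (\<alpha> * L') L\<^sub>u) A' y' z' (\<lambda>r. \<omega> (k, r)) r L n y T1 True"
      "A = A' + step_a A' L" "z = z' - step_a A' L *\<^sub>R grad f y" "T = T' + T1"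
    unfolding catalyst_Suc_iff by blast
  from Suc.prems(2) obtain L2' A2' y2' z2' T2' r2 n2 T12 where
    2: "catalyst f M \<alpha> \<beta> \<gamma> L\<^sub>d L\<^sub>u L0 x0 \<omega> k L2' A2' y2' z2' T2'"
      "passes f M \<beta> \<gamma> L\<^sub>d (\<beta> * min (\<alpha> * L2') L\<^sub>u) A2' y2' z2' (\<lambda>r. \<omega> (k, r)) r2 L2 n2 y2 T12 True"
      "A2 = A2' + step_a A2' L2" "z2 = z2' - step_a A2' L2 *\<^sub>R grad f y2" "T2 = T2' + T12"
    unfolding catalyst_Suc_iff by blast
  have eq: "L' = L2' \<and> A' = A2' \<and> y' = y2' \<and> z' = z2' \<and> T' = T2'"
    using Suc.IH[OF 1(1) 2(1)] .
  with 1(2) 2(2) have "L = L2 \<and> y = y2 \<and> T1 = T12"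
    using passes_exit_unique by blast
  with eq show ?case using 1(3-5) 2(3-5) by simp
qed

lemma catalyst_cong_seed:
  assumes "catalyst f M \<alpha> \<beta> \<gamma> L\<^sub>d L\<^sub>u L0 x0 \<omega> k L A y z T"
    and "\<And>j r. j < k \<Longrightarrow> \<omega> (j, r) = \<omega>' (j, r)"
  shows "catalyst f M \<alpha> \<beta> \<gamma> L\<^sub>d L\<^sub>u L0 x0 \<omega>' k L A y z T"
  using assms
proof (induction rule: catalyst.induct)
  case init
  show ?case by (rule catalyst.init)
next
  case (step k L A y z T r L' n y' T')
  show ?case
    by (rule catalyst.step[OF step.IH passes_cong_seed[OF step.hyps(2)]])
      (use step.prems in auto)
qed

text \<open>The parameters with which the run in slot \<open>(k, r)\<close> is started, whether or
  not this run ever stops. Nothing here refers to \<open>\<omega> (k, r)\<close>, so failure of that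
  run can be described as an event about its own seed alone.\<close>

inductive inner_call ::
  "('a::real_inner \<Rightarrow> real) \<Rightarrow> ('a, 's) inner_method \<Rightarrow> real \<Rightarrow> real \<Rightarrow> real \<Rightarrow> real \<Rightarrow> real
    \<Rightarrow> real \<Rightarrow> 'a \<Rightarrow> (nat \<times> nat \<Rightarrow> 's) \<Rightarrow> nat \<Rightarrow> nat \<Rightarrow> real \<Rightarrow> 'a \<Rightarrow> bool"
  for f M \<alpha> \<beta> \<gamma> L\<^sub>d L\<^sub>u L0 x0 \<omega> k
where
  first: "catalyst f M \<alpha> \<beta> \<gamma> L\<^sub>d L\<^sub>u L0 x0 \<omega> k L A y z T \<Longrightarrow>
    L' = max (\<beta> * min (\<alpha> * L) L\<^sub>u / \<beta>) L\<^sub>d \<Longrightarrow>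
    inner_call f M \<alpha> \<beta> \<gamma> L\<^sub>d L\<^sub>u L0 x0 \<omega> k 1 L' (step_x A y z L')"
| again: "catalyst f M \<alpha> \<beta> \<gamma> L\<^sub>d L\<^sub>u L0 x0 \<omega> k L A y z T \<Longrightarrow>
    passes f M \<beta> \<gamma> L\<^sub>d (\<beta> * min (\<alpha> * L) L\<^sub>u) A y z (\<lambda>r. \<omega> (k, r)) r L1 n y' T' False \<Longrightarrow>
    L' = max (L1 / \<beta>) L\<^sub>d \<Longrightarrow>
    inner_call f M \<alpha> \<beta> \<gamma> L\<^sub>d L\<^sub>u L0 x0 \<omega> k (Suc r) L' (step_x A y z L')"

lemma inner_call_ge: "inner_call f M \<alpha> \<beta> \<gamma> L\<^sub>d L\<^sub>u L0 x0 \<omega> k r L x \<Longrightarrow> 1 \<le> r \<and> L\<^sub>d \<le> L"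
  by (auto elim!: inner_call.cases)

lemma inner_call_unique:
  assumes "inner_call f M \<alpha> \<beta> \<gamma> L\<^sub>d L\<^sub>u L0 x0 \<omega> k r L x"
    and "inner_call f M \<alpha> \<beta> \<gamma> L\<^sub>d L\<^sub>u L0 x0 \<omega> k r L2 x2"
  shows "L = L2 \<and> x = x2"
  using assms(1)
proof cases
  case (first L' A y z T)
  from assms(2) show ?thesis
  proof cases
    case first2: (first L'' A2 y2 z2 T2)
    then show ?thesis using catalyst_unique[OF first(3) first2(3)] first(2,4) first2(2,4) by simp
  next
    case (again L'' A2 y2 z2 T2 r2)
    then show ?thesis using first(1) passes_ge_1[OF again(4)] by simp
  qed
next
  case (again L' A y z T j L1 n y' T')
  from assms(2) show ?thesis
  proof cases
    case (first L'' A2 y2 z2 T2)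
    then show ?thesis using again(1) passes_ge_1[OF again(4)] by simp
  next
    case again2: (again L'' A2 y2 z2 T2 j2 L12 n2 y2' T2')
    then show ?thesis
      using again catalyst_unique[OF again(3) again2(3)]
        passes_unique[of f M \<beta> \<gamma> L\<^sub>d "\<beta> * min (\<alpha> * L') L\<^sub>u" A y z "\<lambda>r. \<omega> (k, r)" j L1 n y' T' False]
      by auto
  qed
qed

text \<open>The strict \<open>i < r\<close> is the point: resampling the seed of the slot itself
  leaves the parameters of its run unchanged.\<close>

lemma inner_call_cong_seed:
  assumes "inner_call f M \<alpha> \<beta> \<gamma> L\<^sub>d L\<^sub>u L0 x0 \<omega> k r L x"
    and "\<And>j i. j < k \<or> j = k \<and> i < r \<Longrightarrow> \<omega> (j, i) = \<omega>' (j, i)"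
  shows "inner_call f M \<alpha> \<beta> \<gamma> L\<^sub>d L\<^sub>u L0 x0 \<omega>' k r L x"
  using assms(1)
proof cases
  case (first L' A y z T)
  have "catalyst f M \<alpha> \<beta> \<gamma> L\<^sub>d L\<^sub>u L0 x0 \<omega>' k L' A y z T"
    by (rule catalyst_cong_seed[OF first(3)]) (use assms(2) in auto)
  then show ?thesis
    unfolding first(1,2) using first(4) by (rule inner_call.first)
next
  case (again L' A y z T j L1 n y' T')
  have "passes f M \<beta> \<gamma> L\<^sub>d (\<beta> * min (\<alpha> * L') L\<^sub>u) A y z (\<lambda>r. \<omega>' (k, r)) j L1 n y' T' False"
    by (rule passes_cong_seed[OF again(4)]) (use assms(2) again(1) in auto)
  moreover have "catalyst f M \<alpha> \<beta> \<gamma> L\<^sub>d L\<^sub>u L0 x0 \<omega>' k L' A y z T"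
    by (rule catalyst_cong_seed[OF again(3)]) (use assms(2) in auto)
  ultimately show ?thesis
    unfolding again(1,2) using again(5) by (intro inner_call.again)
qed

section \<open>Work of successful runs\<close>

text \<open>As long as \<open>L\<close> stays above \<open>L\<^sub>d\<close>, each pass after the
  first has divided it by exactly \<beta>, which gives \<open>r - 1\<close>. A pass clamped to
  \<open>L\<^sub>d\<close> leaves the loop, so at most one pass is not accounted for in this way,
  which gives \<open>r - 2\<close>.\<close>

lemma passes_bounds:
  assumes "passes f M \<beta> \<gamma> L\<^sub>d Linit A y z \<sigma> r L n y' T b" and \<beta>: "1 < \<beta>" and Ld: "0 < L\<^sub>d"
  defines "L1 \<equiv> max (Linit / \<beta>) L\<^sub>d"
  shows "L\<^sub>d \<le> L \<and> L \<le> L1 \<and> (\<not> b \<longrightarrow> L\<^sub>d < L)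
    \<and> (L\<^sub>d < L \<longrightarrow> (real r - 1) * ln \<beta> \<le> ln L1 - ln L)
    \<and> (real r - 2) * ln \<beta> \<le> ln L1 - ln L"
  using assms(1)
proof (induction rule: passes.induct)
  case (first L n y')
  then show ?case using \<beta> by (auto simp: L1_def)
next
  case (again r L n y' T L' n' y'')
  have ln: "0 < ln \<beta>" using \<beta> by simp
  have L: "L\<^sub>d < L" "L \<le> L1" "(real r - 1) * ln \<beta> \<le> ln L1 - ln L" using again.IH by auto
  have Lb: "L / \<beta> < L" using L Ld \<beta> by (simp add: field_simps)
  then have le: "L\<^sub>d \<le> L'" "L' \<le> L" using L(1) unfolding again.hyps(2) by auto
  then have "ln L' \<le> ln L" using Ld by simp
  then have 2: "(real (Suc r) - 2) * ln \<beta> \<le> ln L1 - ln L'" using L(3) by simp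
  have "(real (Suc r) - 1) * ln \<beta> \<le> ln L1 - ln L'" if "L\<^sub>d < L'"
  proof -
    have "ln L' = ln L - ln \<beta>"
      using that L Ld \<beta> by (simp add: again.hyps(2) ln_div)
    then show ?thesis using L(3) by (simp add: algebra_simps)
  qed
  then show ?case using 2 le L(2) by auto
qed

text \<open>
  The values of \<open>L\<close> in one loop form a geometric progression, except that the last one may be
  clamped to \<open>L\<^sub>d\<close>; this costs the additional 1 in the second bound.
\<close>

lemma passes_work:
  assumes "passes f M \<beta> \<gamma> L\<^sub>d Linit A y z \<sigma> r L n y' T b" and \<beta>: "1 < \<beta>" and Ld: "0 < L\<^sub>d"
    and W: "0 \<le> W" and K: "0 \<le> K"
    and run: "\<And>r L n y' T b. passes f M \<beta> \<gamma> L\<^sub>d Linit A y z \<sigma> r L n y' T b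
      \<Longrightarrow> real n \<le> W * (1 + K / L)"
  defines "B \<equiv> \<beta> / (\<beta> - 1)"
  shows "(L\<^sub>d < L \<longrightarrow> real T \<le> W * (real r + K * B / L))
    \<and> real T \<le> W * (real r + K * (B + 1) / L)"
  using assms(1)
proof (induction rule: passes.induct)
  case (first L n y')
  have pos: "0 < L" using first(1) Ld by auto
  have B: "1 \<le> B" using \<beta> by (simp add: B_def)
  have "real n \<le> W * (1 + K / L)" by (rule run, rule passes.first) (use first in auto)
  moreover have "K * 1 / L \<le> K * B / L" "K * B / L \<le> K * (B + 1) / L"
    using B K pos by (intro divide_right_mono mult_left_mono; simp)+
  then have "W * (1 + K / L) \<le> W * (1 + K * B / L)" "W * (1 + K * B / L) \<le> W * (1 + K * (B + 1) / L)"
    using W by (auto intro!: mult_left_mono)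
  ultimately show ?case by simp
next
  case (again r L n y' T L' n' y'')
  have L: "L\<^sub>d < L" using passes_bounds[OF again.hyps(1) \<beta> Ld] by simp
  then have T: "real T \<le> W * (real r + K * B / L)" using again.IH by simp
  have n': "real n' \<le> W * (1 + K / L')"
    by (rule run[OF passes.again[OF again.hyps]])
  have pos: "0 < L'" using again.hyps(2) Ld by auto
  have sum: "real (T + n') \<le> W * (real (Suc r) + (K * B / L + K / L'))"
    using T n' by (simp add: algebra_simps)
  have "L / \<beta> \<le> L" using \<beta> L Ld by (simp add: field_simps)
  then have L'L: "L' \<le> L" unfolding again.hyps(2) using L by simp
  have "K * B / L \<le> K * B / L'"
    using L'L pos K \<beta> by (intro divide_left_mono) (auto simp: B_def)
  then have "K * B / L + K / L' \<le> K * (B + 1) / L'"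
    by (simp add: distrib_left add_divide_distrib)
  then have 2: "real (T + n') \<le> W * (real (Suc r) + K * (B + 1) / L')"
    using sum W by (meson add_left_mono mult_left_mono order_trans)
  \<comment> \<open>\<open>B\<close> is the sum of the geometric series with ratio
    \<open>1 / \<beta>\<close>, so that \<open>B / \<beta> + 1 = B\<close>; this makes the bound
    reproduce itself from pass to pass.\<close>
  have "K * B / L + K / L' = K * B / L'" if "L\<^sub>d < L'"
  proof -
    have "L = L' * \<beta>" using that \<beta> by (auto simp: again.hyps(2) max_def split: if_splits)
    moreover have "B / \<beta> + 1 = B" using \<beta> by (simp add: B_def field_simps)
    then have "K / L' * (B / \<beta> + 1) = K / L' * B" by simp
    ultimately show ?thesis using \<beta> pos by (simp add: field_simps)
  qed
  then show ?case using 2 sum by auto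
qed

text \<open>A loop that is never left would have passes of every index with
  \<open>L > L\<^sub>d\<close>, yet each of them costs a factor \<beta> and the initial value is
  fixed.\<close>

lemma passes_exit_exists:
  assumes \<beta>: "1 < \<beta>" and Ld: "0 < L\<^sub>d"
    and first: "\<exists>n y'. inner_run f M (max (Linit / \<beta>) L\<^sub>d) (step_x A y z (max (Linit / \<beta>) L\<^sub>d)) (\<sigma> 1) n y'"
    and again: "\<And>r L n y' T. passes f M \<beta> \<gamma> L\<^sub>d Linit A y z \<sigma> r L n y' T False
      \<Longrightarrow> \<exists>n y'. inner_run f M (max (L / \<beta>) L\<^sub>d) (step_x A y z (max (L / \<beta>) L\<^sub>d)) (\<sigma> (Suc r)) n y'"
  shows "\<exists>r L n y' T. passes f M \<beta> \<gamma> L\<^sub>d Linit A y z \<sigma> r L n y' T True"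
proof (rule ccontr)
  assume no_exit: "\<not> ?thesis"
  then have no_exit': "\<not> passes f M \<beta> \<gamma> L\<^sub>d Linit A y z \<sigma> r L n y' T True" for r L n y' T
    by blast
  have ex: "\<exists>L n y' T. passes f M \<beta> \<gamma> L\<^sub>d Linit A y z \<sigma> (Suc r) L n y' T False" for r
  proof (induction r)
    case 0
    from first obtain n y' where
      "inner_run f M (max (Linit / \<beta>) L\<^sub>d) (step_x A y z (max (Linit / \<beta>) L\<^sub>d)) (\<sigma> 1) n y'" by blast
    from passes.first[of _ Linit \<beta> L\<^sub>d f M A y z \<sigma>, OF refl this, of \<gamma>] show ?case
      by (metis no_exit' One_nat_def)
  next
    case (Suc r)
    then obtain L n y' T where p: "passes f M \<beta> \<gamma> L\<^sub>d Linit A y z \<sigma> (Suc r) L n y' T False" by blast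
    from again[OF p] obtain n' y'' where
      "inner_run f M (max (L / \<beta>) L\<^sub>d) (step_x A y z (max (L / \<beta>) L\<^sub>d)) (\<sigma> (Suc (Suc r))) n' y''" by blast
    from passes.again[OF p refl this] show ?case by (metis no_exit')
  qed
  define L1 where "L1 = max (Linit / \<beta>) L\<^sub>d"
  have "real r * ln \<beta> \<le> ln L1 - ln L\<^sub>d" for r
  proof -
    obtain L n y' T where "passes f M \<beta> \<gamma> L\<^sub>d Linit A y z \<sigma> (Suc r) L n y' T False"
      using ex by blast
    from passes_bounds[OF this \<beta> Ld] have "real r * ln \<beta> \<le> ln L1 - ln L" "L\<^sub>d < L"
      by (auto simp: L1_def)
    moreover from this(2) Ld have "ln L\<^sub>d \<le> ln L" by simp
    ultimately show ?thesis by simp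
  qed
  moreover obtain r :: nat where "(ln L1 - ln L\<^sub>d) / ln \<beta> < real r" using reals_Archimedean2 by blast
  then have "ln L1 - ln L\<^sub>d < real r * ln \<beta>" using \<beta> by (simp add: field_simps)
  ultimately show False by (meson linorder_not_le)
qed

text \<open>Telescoping weights with total \<delta> over \<open>k \<ge> 0\<close> and
  \<open>r \<ge> 1\<close>. They decay only polynomially, so their logarithms stay logarithmic in
  \<open>k\<close> and \<open>r\<close>.\<close>

definition failure_share :: "real \<Rightarrow> nat \<Rightarrow> nat \<Rightarrow> real" where
  "failure_share \<delta> k r = \<delta> / ((real k + 1) * (real k + 2) * (real r * (real r + 1)))"

text \<open>The value 1/4 is attained by the weights at \<open>k = 0\<close>, \<open>r = 1\<close>.
  It lies within the range \<open>\<delta> \<le> 1 / 2\<close> of the randomized rate, and it makes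
  \<open>ln (t / \<delta>)\<close> at least 1.\<close>

lemma failure_share_bounds:
  assumes "0 < \<delta>" "\<delta> < 1" "1 \<le> r"
  shows "0 < failure_share \<delta> k r" "failure_share \<delta> k r \<le> 1 / 4"
proof -
  have r: "1 \<le> real r" using assms by simp
  have "1 * 2 * (1 * 2) \<le> (real k + 1) * (real k + 2) * (real r * (real r + 1))"
    using r by (intro mult_mono) auto
  then have "\<delta> / ((real k + 1) * (real k + 2) * (real r * (real r + 1))) \<le> 1 / (1 * 2 * (1 * 2))"
    using assms by (intro frac_le) auto
  then show "failure_share \<delta> k r \<le> 1 / 4" by (simp add: failure_share_def)
  show "0 < failure_share \<delta> k r"
    using assms r unfolding failure_share_def by (intro divide_pos_pos mult_pos_pos) auto
qed

text \<open>The logarithm of the product is split and each summand is compared with the terms on the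
  right. \<open>X\<close> stands for \<open>L\<^sub>u / L\<^sub>d\<close> and \<open>E\<close> for
  \<open>L\<^sub>f * R\<^sup>2 / \<epsilon>\<close>; the bound on \<open>k\<close> makes the share
  of the failure probability harmless.\<close>

lemma ln_work_bound:
  assumes q: "1 \<le> q" "q \<le> 2 * X" and X: "1 \<le> X" and Cn: "1 \<le> C\<^sub>n" and C: "0 < C"
    and \<delta>: "0 < \<delta>" "\<delta> < 1" and E: "0 \<le> E" and k: "(real k + 2)\<^sup>2 \<le> 8 * X * (1 + E)"
    and r: "1 \<le> r" "real r \<le> 2 + B * ln X" and B: "1 \<le> B"
  shows "ln (18 * (1 + C) * q ^ 4 * C\<^sub>n / failure_share \<delta> k r)
    \<le> 20 * (1 + C) * B * (1 + ln C\<^sub>n + ln X + ln (1 + E) + ln (1 / \<delta>))"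
proof -
  define k' r' where "k' = real k" and "r' = real r"
  define e where "e = 1 / \<delta>"
  have e: "0 < e" using \<delta> by (simp add: e_def)
  have k0: "0 \<le> k'" and r1: "1 \<le> r'" using r by (auto simp: k'_def r'_def)
  have ln2: "ln (2::real) \<le> 1" using ln_le_minus_one[of 2] by simp
  have ln3: "ln (3::real) \<le> 2" using ln_le_minus_one[of 3] by simp
  have l18: "ln (18::real) = ln 2 + ln 3 + ln 3" using ln_mult[of 2 9] ln_mult[of 3 "3::real"] by simp
  have l8: "ln (8::real) = ln 2 + ln 2 + ln 2" using ln_mult[of 2 4] ln_mult[of 2 "2::real"] by simp
  have "18 * (1 + C) * q ^ 4 * C\<^sub>n / failure_share \<delta> k r
      = 18 * ((1 + C) * (q ^ 4 * (C\<^sub>n * (e * ((k' + 1) * ((k' + 2) * (r' * (r' + 1))))))))"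
    by (simp add: failure_share_def k'_def r'_def e_def)
  also have "ln \<dots> = ln 18 + (ln (1 + C) + (4 * ln q + (ln C\<^sub>n + (ln e
      + (ln (k' + 1) + (ln (k' + 2) + (ln r' + ln (r' + 1))))))))"
    using q C Cn e k0 r1 by (simp add: ln_mult ln_realpow)
  finally have eq: "ln (18 * (1 + C) * q ^ 4 * C\<^sub>n / failure_share \<delta> k r) = \<dots>" .
  have b1: "ln (1 + C) \<le> C" using C ln_add_one_self_le_self by simp
  have "ln q \<le> ln (2 * X)" using q by simp
  then have b2: "ln q \<le> 1 + ln X" using ln2 X by (simp add: ln_mult)
  have "ln (k' + 1) \<le> ln (k' + 2)" using k0 by simp
  moreover have "2 * ln (k' + 2) = ln ((k' + 2)\<^sup>2)" using k0 by (simp add: ln_realpow)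
  moreover have "ln ((k' + 2)\<^sup>2) \<le> ln (8 * X * (1 + E))"
    using k k0 X E by (subst ln_le_cancel_iff) (auto simp: k'_def)
  moreover have "ln (8 * X * (1 + E)) = ln 8 + ln X + ln (1 + E)"
    using X E by (simp add: ln_mult)
  ultimately have b3: "ln (k' + 1) + ln (k' + 2) \<le> 3 + ln X + ln (1 + E)"
    using l8 ln2 by linarith
  \<comment> \<open>Bounding a logarithm by its argument is affordable here, as \<open>r'\<close> is
    itself only logarithmic in \<open>X\<close>.\<close>
  have "ln r' \<le> r'" "ln (r' + 1) \<le> r'"
    using r1 ln_le_minus_one[of r'] ln_add_one_self_le_self[of r'] by (auto simp: add.commute)
  then have b4: "ln r' + ln (r' + 1) \<le> 4 + 2 * (B * ln X)" using r by (simp add: r'_def)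
  have l0: "0 \<le> ln X" "0 \<le> ln C\<^sub>n" "0 \<le> ln (1 + E)" "0 \<le> ln (1 / \<delta>)"
    using X Cn E \<delta> by auto
  let ?F = "1 + ln C\<^sub>n + ln X + ln (1 + E) + ln (1 / \<delta>)"
  \<comment> \<open>The constant 16 is 5 from \<open>ln 18\<close>, 4 from \<open>q ^ 4\<close>, 3
    from \<open>k\<close> and 4 from \<open>r\<close>.\<close>
  have "ln (18 * (1 + C) * q ^ 4 * C\<^sub>n / failure_share \<delta> k r)
      \<le> 16 + C + 5 * ln X + 2 * (B * ln X) + ln C\<^sub>n + ln (1 + E) + ln (1 / \<delta>)"
    using eq b1 b2 b3 b4 l18 ln2 ln3 unfolding e_def by linarith
  also have "\<dots> \<le> 20 * (1 + C) * B + 20 * (1 + C) * B * (ln C\<^sub>n + ln X + ln (1 + E) + ln (1 / \<delta>))"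
  proof -
    define P where "P = (1 + C) * B"
    have "1 * 1 \<le> (1 + C) * B" using C B by (intro mult_mono) auto
    moreover have "(1 + C) * 1 \<le> (1 + C) * B" using C B by (intro mult_left_mono) auto
    ultimately have g: "1 \<le> P" "1 + C \<le> P" by (auto simp: P_def)
    have h: "u \<le> P * u" if "0 \<le> u" for u
      using mult_right_mono[OF g(1) that] by simp
    have "1 * (B * ln X) \<le> (1 + C) * (B * ln X)" using C B l0 by (intro mult_right_mono) auto
    then have "B * ln X \<le> P * ln X" by (simp add: P_def mult.assoc)
    moreover have P: "20 * (1 + C) * B = 20 * P" by (simp add: P_def)
    moreover have "20 * P * (ln C\<^sub>n + ln X + ln (1 + E) + ln (1 / \<delta>))
        = 20 * (P * ln C\<^sub>n) + 20 * (P * ln X) + 20 * (P * ln (1 + E)) + 20 * (P * ln (1 / \<delta>))"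
      by (simp only: distrib_left mult.assoc)
    ultimately show ?thesis
      unfolding P using g h[OF l0(1)] h[OF l0(2)] h[OF l0(3)] h[OF l0(4)] l0 by linarith
  qed
  also have "\<dots> = 20 * (1 + C) * B * ?F" by (simp add: algebra_simps)
  finally show ?thesis .
qed

section \<open>Analysis of a single run whose seeds are all good\<close>

locale catalyst_problem =
  fixes f :: "'a::euclidean_space \<Rightarrow> real" and M :: "('a, 's) inner_method"
    and \<alpha> \<beta> \<gamma> L0 L\<^sub>d L\<^sub>u L\<^sub>f C C\<^sub>n :: real and x0 xstar :: 'a
  assumes convex: "convex_on UNIV f" and smooth: "smooth_fun L\<^sub>f f"
    and minimizer: "f xstar \<le> f y"
    and Ld_pos: "0 < L\<^sub>d" and Ld_less_Lu: "L\<^sub>d < L\<^sub>u" and Ld_le_Lf: "L\<^sub>d \<le> L\<^sub>f" and Lf_le_Lu: "L\<^sub>f \<le> L\<^sub>u"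
    and \<beta>: "1 < \<beta>" and \<alpha>: "\<beta> < \<alpha>" and C_pos: "0 < C" and Cn: "1 \<le> C\<^sub>n"
begin

abbreviation "outer \<equiv> catalyst f M \<alpha> \<beta> \<gamma> L\<^sub>d L\<^sub>u L0 x0"
abbreviation "loop \<omega> k L \<equiv> \<lambda>A y z. passes f M \<beta> \<gamma> L\<^sub>d (\<beta> * min (\<alpha> * L) L\<^sub>u) A y z (\<lambda>r. \<omega> (k, r))"
abbreviation "call \<equiv> inner_call f M \<alpha> \<beta> \<gamma> L\<^sub>d L\<^sub>u L0 x0"
abbreviation "first_guess L \<equiv> max (min (\<alpha> * L) L\<^sub>u) L\<^sub>d"

abbreviation "B \<equiv> \<beta> / (\<beta> - 1)"

definition good_run :: "real \<Rightarrow> (nat \<times> nat \<Rightarrow> 's) \<Rightarrow> bool" where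
  "good_run \<delta> \<omega> \<longleftrightarrow> (\<forall>k r L x. call \<omega> k r L x \<longrightarrow>
    good_seed f M C C\<^sub>n L\<^sub>f L x (\<omega> (k, r)) (failure_share \<delta> k r))"

lemma Lf_pos: "0 < L\<^sub>f" and Lu_pos: "0 < L\<^sub>u"
  using Ld_pos Ld_le_Lf Lf_le_Lu by simp_all

text \<open>\<open>1 / ln \<beta>\<close> counts passes and \<open>B\<close> sums their costs;
  bounding the former by the latter leaves one constant. It is \<open>ln v \<le> v - 1\<close> at
  \<open>v = 1 / \<beta>\<close>.\<close>

lemma ln_beta: "0 < ln \<beta>" and inverse_ln_beta: "1 / ln \<beta> \<le> B" and B_ge_1: "1 \<le> B"
proof -
  show 0: "0 < ln \<beta>" using \<beta> by simp
  have "- ln \<beta> \<le> 1 / \<beta> - 1" using ln_le_minus_one[of "1 / \<beta>"] \<beta> by (simp add: ln_div)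
  then have "(\<beta> - 1) / \<beta> \<le> ln \<beta>" using \<beta> by (simp add: diff_divide_distrib)
  then have "1 / ln \<beta> \<le> 1 / ((\<beta> - 1) / \<beta>)"
    using \<beta> by (intro divide_left_mono) (auto intro!: mult_pos_pos divide_pos_pos)
  then show "1 / ln \<beta> \<le> B" by simp
  show "1 \<le> B" using \<beta> by simp
qed

lemma loop_guess: "max (\<beta> * min (\<alpha> * L) L\<^sub>u / \<beta>) L\<^sub>d = first_guess L"
  using \<beta> by simp

lemma loop_call:
  assumes "outer \<omega> k L A y z T" and "loop \<omega> k L A y z r L' n y' T' b"
  shows "call \<omega> k r L' (step_x A y z L')"
  using assms(2)
proof cases
  case first
  then show ?thesis using inner_call.first[OF assms(1), of L'] by simp
next
  case (again j L1 n1 y1 T1)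
  show ?thesis
    unfolding again(1) by (rule inner_call.again[OF assms(1) again(4,5)])
qed

text \<open>The two bounds on \<open>r\<close> have different uses: the one in terms of
  \<open>L'\<close> telescopes over the outer iterations, the uniform one enters under
  logarithms.\<close>

lemma loop_bounds:
  assumes "loop \<omega> k L A y z r L' n y' T b"
  shows "L\<^sub>d \<le> L'" "L' \<le> L\<^sub>u" "real r \<le> 2 + (ln (first_guess L) - ln L') / ln \<beta>"
    "real r \<le> 2 + B * ln (L\<^sub>u / L\<^sub>d)"
proof -
  note b = passes_bounds[OF assms \<beta> Ld_pos, unfolded loop_guess]
  show Ld: "L\<^sub>d \<le> L'" using b by simp
  have guess: "first_guess L \<le> L\<^sub>u" using Ld_less_Lu by simp
  then show "L' \<le> L\<^sub>u" using b by linarith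
  show r: "real r \<le> 2 + (ln (first_guess L) - ln L') / ln \<beta>"
  proof -
    have "real r - 2 \<le> (ln (first_guess L) - ln L') / ln \<beta>"
      using b ln_beta by (subst pos_le_divide_eq) auto
    then show ?thesis by simp
  qed
  have "ln (first_guess L) \<le> ln L\<^sub>u" "ln L\<^sub>d \<le> ln L'"
    using guess Ld Ld_pos Lu_pos by (subst ln_le_cancel_iff; simp)+
  moreover have "ln (L\<^sub>u / L\<^sub>d) = ln L\<^sub>u - ln L\<^sub>d" using Ld_pos Lu_pos by (simp add: ln_div)
  ultimately have "ln (first_guess L) - ln L' \<le> ln (L\<^sub>u / L\<^sub>d)" by linarith
  then have "(ln (first_guess L) - ln L') / ln \<beta> \<le> ln (L\<^sub>u / L\<^sub>d) / ln \<beta>"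
    using ln_beta by (intro divide_right_mono) auto
  also have "\<dots> \<le> B * ln (L\<^sub>u / L\<^sub>d)"
    using mult_right_mono[OF inverse_ln_beta, of "ln (L\<^sub>u / L\<^sub>d)"] Ld_pos Ld_less_Lu by simp
  finally show "real r \<le> 2 + B * ln (L\<^sub>u / L\<^sub>d)" using r by simp
qed

text \<open>The cost of an inner run per unit of \<open>1 + L\<^sub>f / L\<close>. The 3 is 2 from
  \<open>work_bound\<close> and 1 for its rounding; the rest is the estimate of the
  logarithm.\<close>

definition unit_work :: "real \<Rightarrow> real \<Rightarrow> real" where
  "unit_work E \<delta> = 3 * C\<^sub>n * (20 * (1 + C) * B *
    (1 + ln C\<^sub>n + ln (L\<^sub>u / L\<^sub>d) + ln (1 + E) + ln (1 / \<delta>)))"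

lemma log_sum_ge_1:
  assumes "0 < \<delta>" "\<delta> < 1" "0 \<le> E"
  shows "1 \<le> 1 + ln C\<^sub>n + ln (L\<^sub>u / L\<^sub>d) + ln (1 + E) + ln (1 / \<delta>)"
  using assms Cn Ld_pos Ld_less_Lu by simp

lemma unit_work_nonneg:
  assumes "0 < \<delta>" "\<delta> < 1" "0 \<le> E"
  shows "0 \<le> unit_work E \<delta>"
  unfolding unit_work_def using log_sum_ge_1[OF assms] Cn C_pos B_ge_1
  by (intro mult_nonneg_nonneg) auto

text \<open>Up to the bound on \<open>k\<close>, the shares of the failure probability cost only
  terms already present in the logarithmic factor, so that one \<open>unit_work\<close> serves all
  runs.\<close>

lemma loop_run_length:
  assumes good: "good_run \<delta> \<omega>" and \<delta>: "0 < \<delta>" "\<delta> < 1" and E: "0 \<le> E"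
    and k: "(real k + 2)\<^sup>2 \<le> 8 * (L\<^sub>u / L\<^sub>d) * (1 + E)"
    and outer: "outer \<omega> k L A y z T" and loop: "loop \<omega> k L A y z r L' n y' T' b"
  shows "real n \<le> unit_work E \<delta> * (1 + L\<^sub>f / L')"
proof -
  note bnd = loop_bounds[OF loop]
  have L': "0 < L'" using bnd(1) Ld_pos by simp
  define F where "F = 20 * (1 + C) * B * (1 + ln C\<^sub>n + ln (L\<^sub>u / L\<^sub>d) + ln (1 + E) + ln (1 / \<delta>))"
  have X: "1 \<le> L\<^sub>u / L\<^sub>d" using Ld_pos Ld_less_Lu by simp
  define q where "q = (L\<^sub>f + L') / L'"
  have q: "q = 1 + L\<^sub>f / L'" using L' by (simp add: q_def field_simps)
  have "L\<^sub>f / L' \<le> L\<^sub>u / L\<^sub>d" using bnd(1) Lf_le_Lu Ld_pos Lf_pos by (intro frac_le) auto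
  then have q_le: "q \<le> 2 * (L\<^sub>u / L\<^sub>d)" using X by (simp add: q)
  have q1: "1 \<le> q" using L' Lf_pos by (simp add: q)
  have r1: "1 \<le> r" using passes_ge_1[OF loop] .
  have "ln (18 * (1 + C) * q ^ 4 * C\<^sub>n / failure_share \<delta> k r) \<le> F"
    unfolding F_def by (rule ln_work_bound[OF q1 q_le X Cn C_pos \<delta> E k r1 bnd(4) B_ge_1])
  then have "work_bound C C\<^sub>n L\<^sub>f L' (failure_share \<delta> k r) \<le> 2 * C\<^sub>n * q * F"
    unfolding work_bound_def q_def[symmetric] using Cn q1 by (intro mult_left_mono) auto
  moreover have "1 \<le> C\<^sub>n * q * F"
  proof -
    have "1 * 1 * 1 * 1 \<le> F"
      unfolding F_def using C_pos B_ge_1 log_sum_ge_1[OF \<delta> E]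
      by (intro mult_mono mult_nonneg_nonneg) auto
    moreover have "1 * 1 \<le> C\<^sub>n * q" using Cn q1 by (intro mult_mono) auto
    ultimately show ?thesis
      using mult_mono[of 1 "C\<^sub>n * q" 1 F] by simp
  qed
  ultimately have work: "work_bound C C\<^sub>n L\<^sub>f L' (failure_share \<delta> k r) + 1 \<le> unit_work E \<delta> * q"
    unfolding unit_work_def F_def[symmetric] by (simp add: mult_ac)
  from good loop_call[OF outer loop]
  have "good_seed f M C C\<^sub>n L\<^sub>f L' (step_x A y z L') (\<omega> (k, r)) (failure_share \<delta> k r)"
    by (auto simp: good_run_def)
  then obtain n' y'' where "inner_run f M L' (step_x A y z L') (\<omega> (k, r)) n' y''"
    "real n' \<le> work_bound C C\<^sub>n L\<^sub>f L' (failure_share \<delta> k r) + 1"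
    unfolding good_seed_def by blast
  moreover have "n' = n"
    using inner_run_unique[OF calculation(1) passes_inner_run[OF loop]] by simp
  ultimately show ?thesis using work by (simp add: q)
qed

lemma loop_exit_exists:
  assumes good: "good_run \<delta> \<omega>" and outer: "outer \<omega> k L A y z T"
  shows "\<exists>r L' n y' T'. loop \<omega> k L A y z r L' n y' T' True"
proof (rule passes_exit_exists[OF \<beta> Ld_pos])
  show "\<exists>n y'. inner_run f M (max (\<beta> * min (\<alpha> * L) L\<^sub>u / \<beta>) L\<^sub>d)
      (step_x A y z (max (\<beta> * min (\<alpha> * L) L\<^sub>u / \<beta>) L\<^sub>d)) (\<omega> (k, 1)) n y'"
    using good inner_call.first[OF outer refl] unfolding good_run_def good_seed_def by blast
  show "\<exists>n y'. inner_run f M (max (L1 / \<beta>) L\<^sub>d) (step_x A y z (max (L1 / \<beta>) L\<^sub>d)) (\<omega> (k, Suc r)) n y'"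
    if "loop \<omega> k L A y z r L1 n y' T' False" for r L1 n y' T'
    using good inner_call.again[OF outer that refl] unfolding good_run_def good_seed_def by blast
qed

text \<open>
  The real \<open>l\<close> is \<open>L\<^sub>k\<close> for \<open>k > 0\<close>; since the initial guess \<open>L\<^sub>0\<close> is unrelated to \<open>L\<^sub>d\<close>
  and \<open>L\<^sub>u\<close>, it is \<open>L\<^sub>u\<close> for \<open>k = 0\<close>. The number of passes telescopes through \<open>ln l\<close>, and
  the cost \<open>1 / L\<^sub>k\<close> of an iteration is charged to the growth of \<open>sqrt A\<close>.
\<close>

definition progress :: "real \<Rightarrow> nat \<Rightarrow> real \<Rightarrow> real \<Rightarrow> 'a \<Rightarrow> 'a \<Rightarrow> nat \<Rightarrow> bool" where
  "progress W k L A y z T \<longleftrightarrow> 0 \<le> A \<and>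
    A * (f y - f xstar) + (norm (z - xstar))\<^sup>2 / 2 \<le> (norm (x0 - xstar))\<^sup>2 / 2 \<and>
    real k \<le> 2 * sqrt L\<^sub>u * sqrt A \<and>
    (\<exists>l. L\<^sub>d \<le> l \<and> l \<le> L\<^sub>u \<and> first_guess L \<le> \<alpha> * l \<and>
      real T \<le> W * (real k * (2 + ln \<alpha> / ln \<beta>) + 2 * L\<^sub>f * (B + 1) / sqrt L\<^sub>d * sqrt A
        + (ln L\<^sub>u - ln l) / ln \<beta>))"

lemma progress_init: "progress W 0 L0 0 x0 x0 0"
proof -
  have "first_guess L0 \<le> L\<^sub>u" using Ld_less_Lu by simp
  also have "\<dots> \<le> \<alpha> * L\<^sub>u" using \<alpha> \<beta> Lu_pos by simp
  finally show ?thesis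
    using Ld_less_Lu unfolding progress_def by (intro conjI exI[of _ L\<^sub>u]) auto
qed

text \<open>Since \<open>L' \<le> L\<^sub>u\<close>, the growth of \<open>sqrt A\<close> pays for
  one unit of \<open>k\<close>; since \<open>L' \<ge> L\<^sub>d\<close>, it cannot exceed
  \<open>1 / sqrt L\<^sub>d\<close>. The new witness for \<open>l\<close> is
  \<open>L'\<close>.\<close>

lemma progress_step:
  assumes prog: "progress W k L A y z T" and W: "0 \<le> W"
    and exit: "loop \<omega> k L A y z r L' n y' T' True"
    and run: "\<And>r L' n y' T' b. loop \<omega> k L A y z r L' n y' T' b \<Longrightarrow> real n \<le> W * (1 + L\<^sub>f / L')"
  shows "progress W (Suc k) L' (A + step_a A L') y' (z - step_a A L' *\<^sub>R grad f y') (T + T')"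
    and "sqrt (A + step_a A L') \<le> sqrt A + 1 / sqrt L\<^sub>d"
proof -
  note bnd = loop_bounds[OF exit]
  have L': "0 < L'" using bnd(1) Ld_pos by simp
  have A: "0 \<le> A" using prog by (simp add: progress_def)
  define A' where "A' = A + step_a A L'"
  have A': "0 \<le> A'" using step_a_pos[OF L' A] A by (simp add: A'_def)
  have sqrtA': "sqrt A + 1 / (2 * sqrt L') \<le> sqrt A'" "sqrt A' \<le> sqrt A + 1 / sqrt L'"
    using sqrt_step_a[OF L' A] by (simp_all add: A'_def)
  have "1 / sqrt L' \<le> 1 / sqrt L\<^sub>d" using bnd(1) Ld_pos by (intro divide_left_mono) auto
  then show "sqrt (A + step_a A L') \<le> sqrt A + 1 / sqrt L\<^sub>d"
    using sqrtA'(2) by (simp add: A'_def)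
  have "stop_crit f L' (step_x A y z L') y'"
    using passes_inner_run[OF exit] unfolding inner_run_def by blast
  from energy_decreases[OF convex smooth L' A this, of xstar] prog
  have energy: "A' * (f y' - f xstar) + (norm (z - step_a A L' *\<^sub>R grad f y' - xstar))\<^sup>2 / 2
      \<le> (norm (x0 - xstar))\<^sup>2 / 2"
    by (simp add: progress_def A'_def)
  have "1 / (2 * sqrt L\<^sub>u) \<le> 1 / (2 * sqrt L')"
    using bnd(2) L' by (intro divide_left_mono) auto
  then have "sqrt A + 1 / (2 * sqrt L\<^sub>u) \<le> sqrt A'" using sqrtA'(1) by simp
  then have "2 * sqrt L\<^sub>u * (sqrt A + 1 / (2 * sqrt L\<^sub>u)) \<le> 2 * sqrt L\<^sub>u * sqrt A'"
    using Lu_pos by (intro mult_left_mono) auto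
  moreover have "2 * sqrt L\<^sub>u * (sqrt A + 1 / (2 * sqrt L\<^sub>u)) = 2 * sqrt L\<^sub>u * sqrt A + 1"
    using Lu_pos by (simp add: distrib_left)
  ultimately have count: "real (Suc k) \<le> 2 * sqrt L\<^sub>u * sqrt A'"
    using prog by (simp add: progress_def)
  obtain l where l: "L\<^sub>d \<le> l" "l \<le> L\<^sub>u" "first_guess L \<le> \<alpha> * l" and
    T: "real T \<le> W * (real k * (2 + ln \<alpha> / ln \<beta>) + 2 * L\<^sub>f * (B + 1) / sqrt L\<^sub>d * sqrt A
        + (ln L\<^sub>u - ln l) / ln \<beta>)"
    using prog by (auto simp: progress_def)
  \<comment> \<open>The first guess is at most \<alpha> times the previous value \<open>l\<close>,
    which gives \<open>ln \<alpha> / ln \<beta>\<close> per iteration plus a difference of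
    logarithms that telescopes.\<close>
  have "ln (first_guess L) \<le> ln (\<alpha> * l)"
    using l(3) Ld_pos by (intro ln_mono) auto
  also have "\<dots> = ln \<alpha> + ln l" using \<alpha> \<beta> l(1) Ld_pos by (simp add: ln_mult)
  finally have "(ln (first_guess L) - ln L') / ln \<beta> \<le> (ln \<alpha> + ln l - ln L') / ln \<beta>"
    using ln_beta by (intro divide_right_mono) auto
  then have r: "real r \<le> 2 + ln \<alpha> / ln \<beta> + (ln l - ln L') / ln \<beta>"
    using bnd(3) by (simp add: add_divide_distrib diff_divide_distrib)
  \<comment> \<open>One factor \<open>1 / sqrt L'\<close> is bounded by
    \<open>1 / sqrt L\<^sub>d\<close>, the other by twice the growth of
    \<open>sqrt A\<close>.\<close>
  have "1 / L' = 1 / sqrt L' * (1 / sqrt L')" using L' by simp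
  also have "\<dots> \<le> 1 / sqrt L\<^sub>d * (2 * (sqrt A' - sqrt A))"
    using sqrtA'(1) bnd(1) Ld_pos L'
    by (intro mult_mono divide_left_mono) (auto simp: field_simps)
  finally have "L\<^sub>f * (B + 1) * (1 / L') \<le> L\<^sub>f * (B + 1) * (1 / sqrt L\<^sub>d * (2 * (sqrt A' - sqrt A)))"
    using Lf_pos B_ge_1 by (intro mult_left_mono) auto
  then have cost: "L\<^sub>f * (B + 1) / L' \<le> 2 * L\<^sub>f * (B + 1) / sqrt L\<^sub>d * sqrt A' - 2 * L\<^sub>f * (B + 1) / sqrt L\<^sub>d * sqrt A"
    by (simp add: right_diff_distrib diff_divide_distrib mult_ac)
  have "real T' \<le> W * (real r + L\<^sub>f * (B + 1) / L')"
    using passes_work[OF exit \<beta> Ld_pos W _ run] Lf_pos by simp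
  then have "real (T + T') \<le> W * (real k * (2 + ln \<alpha> / ln \<beta>) + 2 * L\<^sub>f * (B + 1) / sqrt L\<^sub>d * sqrt A
      + (ln L\<^sub>u - ln l) / ln \<beta> + (real r + L\<^sub>f * (B + 1) / L'))"
    using T by (simp only: distrib_left of_nat_add)
  also have "\<dots> \<le> W * (real (Suc k) * (2 + ln \<alpha> / ln \<beta>) + 2 * L\<^sub>f * (B + 1) / sqrt L\<^sub>d * sqrt A'
      + (ln L\<^sub>u - ln L') / ln \<beta>)"
  proof (rule mult_left_mono[OF _ W])
    have "real (Suc k) * (2 + ln \<alpha> / ln \<beta>) = real k * (2 + ln \<alpha> / ln \<beta>) + (2 + ln \<alpha> / ln \<beta>)"
      by (simp add: distrib_right)
    moreover have "(ln L\<^sub>u - ln L') / ln \<beta> = (ln L\<^sub>u - ln l) / ln \<beta> + (ln l - ln L') / ln \<beta>"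
      by (simp add: diff_divide_distrib)
    ultimately show "real k * (2 + ln \<alpha> / ln \<beta>) + 2 * L\<^sub>f * (B + 1) / sqrt L\<^sub>d * sqrt A
      + (ln L\<^sub>u - ln l) / ln \<beta> + (real r + L\<^sub>f * (B + 1) / L')
      \<le> real (Suc k) * (2 + ln \<alpha> / ln \<beta>) + 2 * L\<^sub>f * (B + 1) / sqrt L\<^sub>d * sqrt A'
      + (ln L\<^sub>u - ln L') / ln \<beta>"
      using r cost by linarith
  qed
  finally have work: "real (T + T') \<le> \<dots>" .
  have "1 * L' \<le> \<alpha> * L'" using \<alpha> \<beta> L' by (intro mult_right_mono) auto
  then have "first_guess L' \<le> \<alpha> * L'" using bnd(1) by (simp add: min.coboundedI1)
  then show "progress W (Suc k) L' (A + step_a A L') y' (z - step_a A L' *\<^sub>R grad f y') (T + T')"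
    using A' energy count work bnd(1,2) unfolding progress_def A'_def[symmetric] by blast
qed

text \<open>If the threshold were never reached, \<open>A < a\<close> would persist for all
  \<open>k\<close>, against \<open>real k \<le> 2 * sqrt L\<^sub>u * sqrt A\<close>. The same
  inequality bounds \<open>k\<close> before each step, as the work estimate requires, and the first
  step past \<open>a\<close> starts below it.\<close>

lemma reaches_threshold:
  assumes good: "good_run \<delta> \<omega>" and \<delta>: "0 < \<delta>" "\<delta> < 1" and E: "0 \<le> E" and a: "0 < a"
    and k: "(2 * sqrt L\<^sub>u * sqrt a + 2)\<^sup>2 \<le> 8 * (L\<^sub>u / L\<^sub>d) * (1 + E)"
  shows "\<exists>N L A y z T. outer \<omega> N L A y z T \<and> progress (unit_work E \<delta>) N L A y z T
    \<and> a \<le> A \<and> sqrt A \<le> sqrt a + 1 / sqrt L\<^sub>d"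
proof (rule ccontr)
  assume no: "\<not> ?thesis"
  have below: "\<exists>L A y z T. outer \<omega> k L A y z T \<and> progress (unit_work E \<delta>) k L A y z T \<and> A < a" for k
  proof (induction k)
    case 0
    show ?case using catalyst.init progress_init a by blast
  next
    case (Suc k)
    then obtain L A y z T where outer: "outer \<omega> k L A y z T"
      and prog: "progress (unit_work E \<delta>) k L A y z T" and A: "A < a" by blast
    obtain r L' n y' T' where exit: "loop \<omega> k L A y z r L' n y' T' True"
      using loop_exit_exists[OF good outer] by blast
    have "real k \<le> 2 * sqrt L\<^sub>u * sqrt A" using prog by (simp add: progress_def)
    also have "\<dots> \<le> 2 * sqrt L\<^sub>u * sqrt a" using A Lu_pos by (intro mult_left_mono) auto
    finally have "(real k + 2)\<^sup>2 \<le> (2 * sqrt L\<^sub>u * sqrt a + 2)\<^sup>2" by (intro power_mono) auto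
    also note k
    finally have kb: "(real k + 2)\<^sup>2 \<le> 8 * (L\<^sub>u / L\<^sub>d) * (1 + E)" .
    have run: "real n \<le> unit_work E \<delta> * (1 + L\<^sub>f / L')" if "loop \<omega> k L A y z r L' n y' T' b" for r L' n y' T' b
      by (rule loop_run_length[OF good \<delta> E kb outer that])
    have step: "progress (unit_work E \<delta>) (Suc k) L' (A + step_a A L') y'
        (z - step_a A L' *\<^sub>R grad f y') (T + T')"
      "sqrt (A + step_a A L') \<le> sqrt A + 1 / sqrt L\<^sub>d"
      by (rule progress_step[OF prog unit_work_nonneg[OF \<delta> E] exit], erule run)+
    have next_outer: "outer \<omega> (Suc k) L' (A + step_a A L') y' (z - step_a A L' *\<^sub>R grad f y') (T + T')"
      by (rule catalyst.step[OF outer exit])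
    moreover have "sqrt (A + step_a A L') \<le> sqrt a + 1 / sqrt L\<^sub>d"
      using step(2) real_sqrt_le_mono[OF less_imp_le[OF A]] by linarith
    ultimately have "\<not> a \<le> A + step_a A L'" using no step(1) by blast
    then show ?case using next_outer step(1) by (meson not_le)
  qed
  have "real k \<le> 2 * sqrt L\<^sub>u * sqrt a" for k
  proof -
    from below obtain L A y z T where "progress (unit_work E \<delta>) k L A y z T" "A < a" by blast
    then have "real k \<le> 2 * sqrt L\<^sub>u * sqrt A" "sqrt A \<le> sqrt a" by (auto simp: progress_def)
    moreover have "2 * sqrt L\<^sub>u * sqrt A \<le> 2 * sqrt L\<^sub>u * sqrt a"
      using calculation(2) Lu_pos by (intro mult_left_mono) auto
    ultimately show ?thesis by simp
  qed
  then show False using reals_Archimedean2 by (meson not_le)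
qed

text \<open>The energy bound at the threshold \<open>a = R\<^sup>2 / (2 * \<epsilon>)\<close> yields
  accuracy \<epsilon>. The number of passes is governed by \<open>sqrt L\<^sub>u\<close> and the
  rest of the work by \<open>L\<^sub>f / sqrt L\<^sub>d\<close>, each times \<open>sqrt A\<close>;
  they give the two arguments of the maximum.\<close>

lemma good_run_complexity:
  assumes good: "good_run \<delta> \<omega>" and \<delta>: "0 < \<delta>" "\<delta> < 1"
    and R: "R = norm (x0 - xstar)" "R \<noteq> 0" and \<epsilon>: "0 < \<epsilon>" and \<kappa>: "\<epsilon> \<le> \<kappa> * (L\<^sub>d * R\<^sup>2)"
  shows "\<exists>N L A y z T. outer \<omega> N L A y z T \<and> f y - f xstar \<le> \<epsilon> \<and>
    real T \<le> bound_const \<alpha> \<beta> C \<kappa> * log_factor C\<^sub>n L\<^sub>d L\<^sub>u L\<^sub>f R \<epsilon> \<delta> *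
      (C\<^sub>n * max (sqrt (L\<^sub>u / L\<^sub>f)) (sqrt (L\<^sub>f / L\<^sub>d)) * sqrt (L\<^sub>f * R\<^sup>2 / \<epsilon>))"
proof -
  define E where "E = L\<^sub>f * R\<^sup>2 / \<epsilon>"
  define a where "a = R\<^sup>2 / (2 * \<epsilon>)"
  define \<rho> where "\<rho> = R / sqrt \<epsilon>"
  define U where "U = unit_work E \<delta>"
  define P where "P = max (sqrt (L\<^sub>u / L\<^sub>f)) (sqrt (L\<^sub>f / L\<^sub>d)) * sqrt (L\<^sub>f * R\<^sup>2 / \<epsilon>)"
  have R0: "0 < R" using R by simp
  have \<rho>: "0 < \<rho>" using R0 \<epsilon> by (simp add: \<rho>_def)
  have \<rho>2: "\<rho>\<^sup>2 = R\<^sup>2 / \<epsilon>" using \<epsilon> by (simp add: \<rho>_def power_divide)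
  have E: "0 \<le> E" using Lf_pos \<epsilon> by (simp add: E_def)
  have E_eq: "E = L\<^sub>f * \<rho>\<^sup>2" by (simp add: E_def \<rho>2)
  have a: "0 < a" using R0 \<epsilon> by (simp add: a_def)
  have a_eq: "a = \<rho>\<^sup>2 / 2" by (simp add: a_def \<rho>2)
  have sqrt_a: "sqrt a \<le> \<rho>"
    using \<rho> by (intro real_le_lsqrt) (auto simp: a_eq)
  define u where "u = 2 * sqrt L\<^sub>u * sqrt a"
  have u2: "u\<^sup>2 = 2 * L\<^sub>u * \<rho>\<^sup>2" using Lu_pos by (simp add: u_def a_eq power_mult_distrib)
  \<comment> \<open>Origin of the 8 in the bound on \<open>k\<close>: \<open>2 * u\<^sup>2\<close>
    is at most \<open>4 * (L\<^sub>u / L\<^sub>d) * E\<close>, and the additive 8 is covered by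
    \<open>L\<^sub>u / L\<^sub>d \<ge> 1\<close>.\<close>
  have "(u + 2)\<^sup>2 \<le> 2 * u\<^sup>2 + 8"
    using sum_squares_bound[of u 2] by (simp add: power2_sum)
  also have "\<dots> \<le> 8 * (L\<^sub>u / L\<^sub>d) * (1 + E)"
  proof -
    have "1 \<le> L\<^sub>u / L\<^sub>d" using Ld_pos Ld_less_Lu by simp
    moreover have "L\<^sub>u * \<rho>\<^sup>2 \<le> L\<^sub>u / L\<^sub>d * E"
    proof -
      have "L\<^sub>u * \<rho>\<^sup>2 * 1 \<le> L\<^sub>u * \<rho>\<^sup>2 * (L\<^sub>f / L\<^sub>d)"
        using Lu_pos Ld_pos Ld_le_Lf by (intro mult_left_mono) auto
      then show ?thesis by (simp add: E_eq mult_ac)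
    qed
    moreover have "0 \<le> L\<^sub>u * \<rho>\<^sup>2" using Lu_pos by simp
    ultimately show ?thesis unfolding u2 by (simp add: distrib_left)
  qed
  finally obtain N L A y z T where outer: "outer \<omega> N L A y z T" and prog: "progress U N L A y z T"
    and A: "a \<le> A" "sqrt A \<le> sqrt a + 1 / sqrt L\<^sub>d"
    using reaches_threshold[OF good \<delta> E a] unfolding u_def U_def by blast
  have gap0: "0 \<le> f y - f xstar" using minimizer by simp
  have "a * (f y - f xstar) \<le> A * (f y - f xstar)" using A gap0 by (intro mult_right_mono)
  also have "\<dots> \<le> R\<^sup>2 / 2"
  proof -
    have "A * (f y - f xstar) + (norm (z - xstar))\<^sup>2 / 2 \<le> R\<^sup>2 / 2"
      using prog by (simp add: progress_def R(1))
    moreover have "0 \<le> (norm (z - xstar))\<^sup>2 / 2" by simp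
    ultimately show ?thesis by linarith
  qed
  also have "\<dots> = a * \<epsilon>" using \<epsilon> by (simp add: a_def)
  finally have gap: "f y - f xstar \<le> \<epsilon>" using a by simp

  \<comment> \<open>Here \<kappa> converts the overshoot \<open>1 / sqrt L\<^sub>d\<close> into a
    multiple of \<open>\<rho>\<close>, the scale of \<open>sqrt a\<close>.\<close>
  have "1 \<le> \<kappa> * L\<^sub>d * \<rho>\<^sup>2" using \<kappa> \<epsilon> by (simp add: \<rho>2 field_simps)
  then have "1 / L\<^sub>d \<le> \<kappa> * \<rho>\<^sup>2" using Ld_pos by (simp add: field_simps)
  then have "sqrt (1 / L\<^sub>d) \<le> sqrt (\<kappa> * \<rho>\<^sup>2)" by (rule real_sqrt_le_mono)
  then have inv_Ld: "1 / sqrt L\<^sub>d \<le> sqrt \<kappa> * \<rho>"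
    using \<rho> by (simp add: real_sqrt_mult real_sqrt_divide)
  have \<kappa>0: "0 \<le> sqrt \<kappa>"
  proof -
    have "0 < \<kappa> * (L\<^sub>d * R\<^sup>2)" using \<kappa> \<epsilon> by linarith
    then have "0 < \<kappa>" using Ld_pos by (auto simp: zero_less_mult_iff mult_less_0_iff)
    then show ?thesis by simp
  qed
  have sqrtA: "sqrt A \<le> (1 + sqrt \<kappa>) * \<rho>"
    using A(2) sqrt_a inv_Ld by (simp add: distrib_right)
  have sqrt_D: "sqrt (L\<^sub>f * R\<^sup>2 / \<epsilon>) = sqrt L\<^sub>f * \<rho>"
    using R0 \<epsilon> by (simp add: \<rho>_def real_sqrt_mult real_sqrt_divide)
  have "sqrt L\<^sub>u * \<rho> = sqrt (L\<^sub>u / L\<^sub>f) * (sqrt L\<^sub>f * \<rho>)"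
    using Lf_pos by (simp add: real_sqrt_divide)
  also have "\<dots> \<le> P"
    unfolding P_def sqrt_D using Lf_pos \<rho> by (intro mult_right_mono) auto
  finally have PLu: "sqrt L\<^sub>u * \<rho> \<le> P" .
  have "L\<^sub>f / sqrt L\<^sub>d * \<rho> = sqrt (L\<^sub>f / L\<^sub>d) * (sqrt L\<^sub>f * \<rho>)"
    using Lf_pos by (simp add: real_sqrt_divide)
  also have "\<dots> \<le> P"
    unfolding P_def sqrt_D using Lf_pos \<rho> by (intro mult_right_mono) auto
  finally have PLd: "L\<^sub>f / sqrt L\<^sub>d * \<rho> \<le> P" .
  have "0 \<le> sqrt L\<^sub>u * \<rho>" using Lu_pos \<rho> by simp
  with PLu have P0: "0 \<le> P" by linarith
  define Q where "Q = (1 + sqrt \<kappa>) * P"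
  have Q0: "0 \<le> Q" using P0 \<kappa>0 by (simp add: Q_def)
  have QLu: "sqrt L\<^sub>u * sqrt A \<le> Q"
  proof -
    have "sqrt L\<^sub>u * sqrt A \<le> sqrt L\<^sub>u * ((1 + sqrt \<kappa>) * \<rho>)"
      using sqrtA Lu_pos by (intro mult_left_mono) auto
    also have "\<dots> = (1 + sqrt \<kappa>) * (sqrt L\<^sub>u * \<rho>)" by simp
    also have "\<dots> \<le> Q" unfolding Q_def using PLu \<kappa>0 by (intro mult_left_mono) auto
    finally show ?thesis .
  qed
  have QLd: "L\<^sub>f / sqrt L\<^sub>d * sqrt A \<le> Q"
  proof -
    have "L\<^sub>f / sqrt L\<^sub>d * sqrt A \<le> L\<^sub>f / sqrt L\<^sub>d * ((1 + sqrt \<kappa>) * \<rho>)"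
      using sqrtA Lf_pos Ld_pos by (intro mult_left_mono) auto
    also have "\<dots> = (1 + sqrt \<kappa>) * (L\<^sub>f / sqrt L\<^sub>d * \<rho>)" by simp
    also have "\<dots> \<le> Q" unfolding Q_def using PLd \<kappa>0 by (intro mult_left_mono) auto
    finally show ?thesis .
  qed

  have \<alpha>1: "1 \<le> \<alpha>" using \<alpha> \<beta> by simp
  have B2: "B + 1 \<le> 2 * (\<alpha> * B)"
  proof -
    have "1 * B \<le> \<alpha> * B" using \<alpha>1 B_ge_1 by (intro mult_right_mono) auto
    then show ?thesis using B_ge_1 by linarith
  qed
  have passes_const: "2 + ln \<alpha> / ln \<beta> \<le> 2 * (\<alpha> * B)"
  proof -
    have "ln \<alpha> / ln \<beta> = ln \<alpha> * (1 / ln \<beta>)" by simp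
    also have "\<dots> \<le> (\<alpha> - 1) * B"
      using \<alpha>1 ln_le_minus_one[of \<alpha>] inverse_ln_beta ln_beta by (intro mult_mono) auto
    finally show ?thesis using B2 B_ge_1 by (simp only: left_diff_distrib)
  qed
  obtain l where l: "L\<^sub>d \<le> l" "l \<le> L\<^sub>u" and
    T: "real T \<le> U * (real N * (2 + ln \<alpha> / ln \<beta>) + 2 * L\<^sub>f * (B + 1) / sqrt L\<^sub>d * sqrt A
        + (ln L\<^sub>u - ln l) / ln \<beta>)"
    using prog unfolding progress_def by blast
  have t1: "real N * (2 + ln \<alpha> / ln \<beta>) \<le> 4 * (\<alpha> * B * Q)"
  proof -
    have "real N \<le> 2 * Q" using prog QLu by (simp add: progress_def)
    then have "real N * (2 + ln \<alpha> / ln \<beta>) \<le> 2 * Q * (2 * (\<alpha> * B))"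
      using passes_const Q0 \<alpha>1 ln_beta by (intro mult_mono) auto
    then show ?thesis by (simp add: mult_ac)
  qed
  have t2: "2 * L\<^sub>f * (B + 1) / sqrt L\<^sub>d * sqrt A \<le> 4 * (\<alpha> * B * Q)"
  proof -
    have "2 * L\<^sub>f * (B + 1) / sqrt L\<^sub>d * sqrt A = 2 * (B + 1) * (L\<^sub>f / sqrt L\<^sub>d * sqrt A)" by simp
    also have "\<dots> \<le> 2 * (2 * (\<alpha> * B)) * Q"
      using B2 B_ge_1 QLd Lf_pos Ld_pos prog \<alpha>1
      by (intro mult_mono) (auto simp: progress_def intro!: mult_nonneg_nonneg)
    finally show ?thesis by (simp add: mult_ac)
  qed
  \<comment> \<open>Each outer iteration pays for its own passes up to this telescoped remainder. It
    is bounded through \<open>ln v = 2 * ln (sqrt v) \<le> 2 * sqrt v\<close> and once more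
    \<open>inv_Ld\<close>.\<close>
  have t3: "(ln L\<^sub>u - ln l) / ln \<beta> \<le> 2 * (\<alpha> * B * Q)"
  proof -
    have "ln L\<^sub>d \<le> ln l" using l Ld_pos by simp
    then have "ln L\<^sub>u - ln l \<le> ln (L\<^sub>u / L\<^sub>d)" using Ld_pos Lu_pos ln_div[of L\<^sub>u L\<^sub>d] by simp
    also have "\<dots> = 2 * ln (sqrt (L\<^sub>u / L\<^sub>d))" using Ld_pos Lu_pos by (simp add: ln_sqrt)
    also have "\<dots> \<le> 2 * sqrt (L\<^sub>u / L\<^sub>d)"
      using ln_le_minus_one[of "sqrt (L\<^sub>u / L\<^sub>d)"] Ld_pos Lu_pos by simp
    also have "sqrt (L\<^sub>u / L\<^sub>d) = sqrt L\<^sub>u * (1 / sqrt L\<^sub>d)" by (simp add: real_sqrt_divide)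
    also have "\<dots> \<le> sqrt L\<^sub>u * (sqrt \<kappa> * \<rho>)"
      using inv_Ld Lu_pos by (intro mult_left_mono) auto
    also have "\<dots> = sqrt \<kappa> * (sqrt L\<^sub>u * \<rho>)" by simp
    also have "\<dots> \<le> sqrt \<kappa> * P" using PLu \<kappa>0 by (intro mult_left_mono)
    also have "\<dots> \<le> Q" using P0 by (simp add: Q_def distrib_right)
    finally have ln_Q: "ln L\<^sub>u - ln l \<le> 2 * Q" by simp
    have "(ln L\<^sub>u - ln l) / ln \<beta> = (ln L\<^sub>u - ln l) * (1 / ln \<beta>)" by simp
    also have "\<dots> \<le> 2 * Q * B"
      using ln_Q inverse_ln_beta ln_beta Q0 by (intro mult_mono) auto
    also have "\<dots> \<le> 2 * Q * (\<alpha> * B)"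
    proof -
      have "1 * B \<le> \<alpha> * B" using \<alpha>1 B_ge_1 by (intro mult_right_mono) auto
      then show ?thesis using Q0 by (intro mult_left_mono) auto
    qed
    finally show ?thesis by (simp add: mult_ac)
  qed
  have U0: "0 \<le> U" unfolding U_def by (rule unit_work_nonneg[OF \<delta> E])
  define F where "F = log_factor C\<^sub>n L\<^sub>d L\<^sub>u L\<^sub>f R \<epsilon> \<delta>"
  have F: "1 \<le> F" using log_sum_ge_1[OF \<delta> E] by (simp add: F_def log_factor_def E_def)
  have U: "U = 3 * C\<^sub>n * (20 * (1 + C) * B * F)"
    by (simp add: U_def unit_work_def F_def log_factor_def E_def)
  note T
  also have "U * (real N * (2 + ln \<alpha> / ln \<beta>) + 2 * L\<^sub>f * (B + 1) / sqrt L\<^sub>d * sqrt A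
        + (ln L\<^sub>u - ln l) / ln \<beta>) \<le> U * (10 * (\<alpha> * B * Q))"
  proof (rule mult_left_mono[OF order_trans[OF add_mono[OF add_mono[OF t1 t2] t3]] U0])
    have "4 * v + 4 * v + 2 * v = 10 * v" for v :: real by simp
    then show "4 * (\<alpha> * B * Q) + 4 * (\<alpha> * B * Q) + 2 * (\<alpha> * B * Q) \<le> 10 * (\<alpha> * B * Q)"
      by (simp only: order_refl)
  qed
  \<comment> \<open>The 600 is 3 * 20 from \<open>U\<close> times the 10 = 4 + 4 + 2 from
    \<open>t1\<close>, \<open>t2\<close> and \<open>t3\<close>.\<close>
  also have "\<dots> = 600 * ((1 + C) * \<alpha> * B\<^sup>2 * (1 + sqrt \<kappa>) * F * (C\<^sub>n * P))"
    unfolding U Q_def power2_eq_square by (simp only: mult_ac) simp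
  also have "\<dots> \<le> 1000 * ((1 + C) * \<alpha> * B\<^sup>2 * (1 + sqrt \<kappa>) * F * (C\<^sub>n * P))"
    using C_pos \<alpha>1 \<kappa>0 F Cn P0 by (intro mult_right_mono mult_nonneg_nonneg) auto
  also have "\<dots> = bound_const \<alpha> \<beta> C \<kappa> * F * (C\<^sub>n * P)"
    by (simp add: bound_const_def mult_ac)
  finally have "real T \<le> bound_const \<alpha> \<beta> C \<kappa> * log_factor C\<^sub>n L\<^sub>d L\<^sub>u L\<^sub>f R \<epsilon> \<delta> *
      (C\<^sub>n * max (sqrt (L\<^sub>u / L\<^sub>f)) (sqrt (L\<^sub>f / L\<^sub>d)) * sqrt (L\<^sub>f * R\<^sup>2 / \<epsilon>))"
    unfolding F_def P_def by (simp only: mult.assoc)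
  with outer gap show ?thesis by blast
qed

end

section \<open>Probability of success\<close>

lemma prob_space_seeds: "prob_space S \<Longrightarrow> prob_space (seeds S)"
  unfolding seeds_def by (rule prob_space_PiM)

lemma measurable_seed: "(\<lambda>\<omega>. \<omega> i) \<in> measurable (seeds S) S"
  unfolding seeds_def by measurable

text \<open>Overwriting one coordinate by an independent draw preserves the product measure, so by
  Fubini the measure of \<open>A\<close> is the average of the probabilities bounded in
  \<open>resample\<close>.\<close>

lemma measure_seeds_le:
  assumes S: "prob_space S" and A: "A \<in> sets (seeds S)"
    and d: "0 \<le> d" and resample: "\<And>\<omega>. \<omega> \<in> space (seeds S) \<Longrightarrow> measure S {s \<in> space S. fun_upd \<omega> i s \<in> A} \<le> d"
  shows "measure (seeds S) A \<le> d"
proof -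
  interpret S: prob_space S by fact
  interpret P: prob_space "seeds S" by (rule prob_space_seeds[OF S])
  interpret SP: pair_sigma_finite S "seeds S" ..
  let ?u = "\<lambda>(s, \<omega>). fun_upd \<omega> i s"
  have u: "?u \<in> measurable (S \<Otimes>\<^sub>M seeds S) (seeds S)"
    unfolding seeds_def split_def by (rule measurable_fun_upd[where J = UNIV]) auto
  have distr: "distr (S \<Otimes>\<^sub>M seeds S) (seeds S) ?u = seeds S"
    using distr_pair_PiM_eq_PiM[of UNIV "\<lambda>_. S" i] S by (simp add: seeds_def)
  let ?A = "?u -` A \<inter> space (S \<Otimes>\<^sub>M seeds S)"
  have A': "?A \<in> sets (S \<Otimes>\<^sub>M seeds S)" using u A by (rule measurable_sets)
  have "emeasure (seeds S) A = emeasure (S \<Otimes>\<^sub>M seeds S) ?A"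
    using emeasure_distr[OF u A] distr by simp
  also have "\<dots> = (\<integral>\<^sup>+ \<omega>. emeasure S ((\<lambda>s. (s, \<omega>)) -` ?A) \<partial>seeds S)"
    by (rule SP.emeasure_pair_measure_alt2[OF A'])
  also have "\<dots> \<le> (\<integral>\<^sup>+ \<omega>. ennreal d \<partial>seeds S)"
  proof (rule nn_integral_mono)
    fix \<omega> assume \<omega>: "\<omega> \<in> space (seeds S)"
    have "(\<lambda>s. (s, \<omega>)) -` ?A = {s \<in> space S. fun_upd \<omega> i s \<in> A}"
      using \<omega> by (auto simp: space_pair_measure)
    then show "emeasure S ((\<lambda>s. (s, \<omega>)) -` ?A) \<le> ennreal d"
      using resample[OF \<omega>] d by (simp add: S.emeasure_eq_measure)
  qed
  also have "\<dots> = ennreal d" by (simp add: P.emeasure_space_1)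
  finally show ?thesis using d by (simp add: P.emeasure_eq_measure)
qed

lemma sums_inverse_consecutive: "(\<lambda>n. 1 / ((real n + 1) * (real n + 2))) sums 1"
proof -
  have "(\<lambda>n. 1 / real (Suc n)) \<longlonglongrightarrow> 0"
    by (rule LIMSEQ_Suc[OF lim_1_over_n])
  from telescope_sums'[OF this]
  have "(\<lambda>n. 1 / real (Suc n) - 1 / real (Suc (Suc n))) sums 1" by simp
  moreover have "1 / real (Suc n) - 1 / real (Suc (Suc n)) = 1 / ((real n + 1) * (real n + 2))" for n
    by (simp add: field_simps)
  ultimately show ?thesis by simp
qed

section \<open>Measurability of runs, and the deterministic rate\<close>

lemma borel_measurable_step_a [measurable]:
  assumes [measurable]: "A \<in> borel_measurable X" "L \<in> borel_measurable X"
  shows "(\<lambda>\<xi>. step_a (A \<xi>) (L \<xi>)) \<in> borel_measurable X"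
  unfolding step_a_def by measurable

lemma borel_measurable_step_x [measurable]:
  fixes y z :: "'x \<Rightarrow> 'a::euclidean_space"
  assumes [measurable]: "A \<in> borel_measurable X" "L \<in> borel_measurable X"
    "y \<in> borel_measurable X" "z \<in> borel_measurable X"
  shows "(\<lambda>\<xi>. step_x (A \<xi>) (y \<xi>) (z \<xi>) (L \<xi>)) \<in> borel_measurable X"
  unfolding step_x_def by measurable

context catalyst_problem
begin

lemma borel_measurable_f [measurable]: "f \<in> borel_measurable borel"
  by (rule borel_measurable_continuous_onI[OF continuous_smooth_fun[OF smooth]])

lemma borel_measurable_grad [measurable]: "grad f \<in> borel_measurable borel"
  using smooth unfolding smooth_fun_def
  by (intro borel_measurable_continuous_onI lipschitz_on_continuous_on) auto

lemma minimizer_aux_fun: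
  assumes "0 < L"
  shows "\<exists>ystar. \<forall>y. aux_fun f L x ystar \<le> aux_fun f L x y"
  by (rule ex_minimizer_aux_fun[OF continuous_smooth_fun[OF smooth] minimizer assms])

text \<open>As \<open>t \<ge> 1\<close> and a share is at most 1/4,
  \<open>ln (t / ?d) \<ge> 1\<close>; so the rate without the logarithm implies the one with it, for
  every seed.\<close>

lemma good_run_of_deterministic_rate:
  assumes rate: "\<And>L x. 0 < L \<Longrightarrow> deterministic_rate S M C C\<^sub>n (aux_fun f L x) L (L\<^sub>f + L)"
    and \<delta>: "0 < \<delta>" "\<delta> < 1" and \<omega>: "\<omega> \<in> space (seeds S)"
  shows "good_run \<delta> \<omega>"
  unfolding good_run_def
proof (intro allI impI)
  fix k r L x assume "call \<omega> k r L x"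
  then have r: "1 \<le> r" and L: "0 < L" using inner_call_ge Ld_pos by fastforce+
  let ?d = "failure_share \<delta> k r" and ?s = "\<omega> (k, r)"
  define t where "t = nat \<lceil>work_bound C C\<^sub>n L\<^sub>f L ?d\<rceil>"
  note d = failure_share_bounds[OF \<delta> r, of k]
  have s: "?s \<in> space S" using \<omega> by (auto simp: seeds_def space_PiM)
  obtain ystar where ystar: "\<And>y. aux_fun f L x ystar \<le> aux_fun f L x y"
    using minimizer_aux_fun[OF L, of x] by blast
  show "good_seed f M C C\<^sub>n L\<^sub>f L x ?s ?d"
  proof (rule good_seed_of_rate[OF convex smooth L ystar C_pos Cn d])
    let ?b = "C * (L\<^sub>f + L) * (norm (x - ystar))\<^sup>2"
    have t: "1 \<le> t"
      using work_bound_pos[OF less_imp_le[OF Lf_pos] L C_pos Cn d(1)] d(2) unfolding t_def by linarith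
    have "1 / (1 / 4) \<le> real t / ?d" using t d by (intro frac_le) auto
    then have "ln 4 \<le> ln (real t / ?d)" by simp
    moreover have "1 / 2 \<le> ln (2::real)" using ln_le_minus_one[of "1 / 2"] by (simp add: ln_div)
    then have "1 \<le> ln (4::real)" using ln_mult[of 2 "2::real"] by simp
    ultimately have "1 \<le> ln (real t / ?d)" by simp
    then have b: "?b * 1 \<le> ?b * ln (real t / ?d)"
      using C_pos Lf_pos L by (intro mult_left_mono) auto
    have rate0: "0 \<le> rate C\<^sub>n L (L\<^sub>f + L) t" using Cn by (simp add: rate_def)
    have "aux_fun f L x (M (aux_fun f L x) x ?s t) - aux_fun f L x ystar \<le> ?b * rate C\<^sub>n L (L\<^sub>f + L) t"
      using rate[OF L, of x] ystar t s unfolding deterministic_rate_def by blast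
    also have "\<dots> \<le> ?b * ln (real t / ?d) * rate C\<^sub>n L (L\<^sub>f + L) t"
      using mult_right_mono[OF b rate0] by simp
    finally show "aux_fun f L x (M (aux_fun f L x) x ?s (nat \<lceil>work_bound C C\<^sub>n L\<^sub>f L ?d\<rceil>)) - aux_fun f L x ystar
      \<le> ?b * ln (real (nat \<lceil>work_bound C C\<^sub>n L\<^sub>f L ?d\<rceil>) / ?d) * rate C\<^sub>n L (L\<^sub>f + L) (nat \<lceil>work_bound C C\<^sub>n L\<^sub>f L ?d\<rceil>)"
      unfolding t_def .
  qed
qed

end

locale randomized_problem = catalyst_problem f M \<alpha> \<beta> \<gamma> L0 L\<^sub>d L\<^sub>u L\<^sub>f C C\<^sub>n x0 xstar + S: prob_space S
  for f :: "'a::euclidean_space \<Rightarrow> real" and M :: "('a, 's) inner_method"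
    and \<alpha> \<beta> \<gamma> L0 L\<^sub>d L\<^sub>u L\<^sub>f C C\<^sub>n :: real and x0 xstar :: 'a and S :: "'s measure" +
  assumes method_measurable: "(\<lambda>(L, x, s). M (aux_fun f L x) x s t)
      \<in> borel_measurable (restrict_space borel {0<..} \<Otimes>\<^sub>M (borel \<Otimes>\<^sub>M S))"
    and method_rate: "0 < L \<Longrightarrow> randomized_rate S M C C\<^sub>n (aux_fun f L x) L (L\<^sub>f + L)"
begin

text \<open>The assumption on the method covers positive \<open>L\<close>; the bound by
  \<open>L\<^sub>d\<close> keeps the composed parameter in that restricted space.\<close>

lemma borel_measurable_output:
  assumes [measurable]: "L \<in> borel_measurable X" "x \<in> borel_measurable X" "s \<in> measurable X S"
    and L: "\<And>\<xi>. L\<^sub>d \<le> L \<xi>"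
  shows "(\<lambda>\<xi>. M (aux_fun f (L \<xi>) (x \<xi>)) (x \<xi>) (s \<xi>) t) \<in> borel_measurable X"
proof -
  have "0 < L \<xi>" for \<xi> using L[of \<xi>] Ld_pos by simp
  then have [measurable]: "L \<in> measurable X (restrict_space borel {0<..})"
    using assms(1) by (intro measurable_restrict_space2) auto
  have "(\<lambda>\<xi>. (L \<xi>, x \<xi>, s \<xi>)) \<in> measurable X (restrict_space borel {0<..} \<Otimes>\<^sub>M (borel \<Otimes>\<^sub>M S))"
    by measurable
  from measurable_compose[OF this method_measurable[of t]] show ?thesis by simp
qed

lemma pred_inner_run:
  assumes [measurable]: "L \<in> borel_measurable X" "x \<in> borel_measurable X" "s \<in> measurable X S"
    and L: "\<And>\<xi>. L\<^sub>d \<le> L \<xi>"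
  shows "Measurable.pred X (\<lambda>\<xi>. inner_run f M (L \<xi>) (x \<xi>) (s \<xi>) n
    (M (aux_fun f (L \<xi>) (x \<xi>)) (x \<xi>) (s \<xi>) n))"
proof -
  note [measurable] = borel_measurable_output[OF assms]
  show ?thesis
    unfolding inner_run_def stop_crit_def grad_aux_fun[OF smooth] by measurable
qed

lemma pred_good_seed:
  assumes [measurable]: "L \<in> borel_measurable X" "x \<in> borel_measurable X" "s \<in> measurable X S"
    and L: "\<And>\<xi>. L\<^sub>d \<le> L \<xi>"
  shows "Measurable.pred X (\<lambda>\<xi>. good_seed f M C C\<^sub>n L\<^sub>f (L \<xi>) (x \<xi>) (s \<xi>) d)"
proof -
  note [measurable] = pred_inner_run[OF assms]
  show ?thesis unfolding good_seed_def work_bound_def by measurable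
qed

text \<open>
  The relations describing a run are not functions, so their measurability is stated in the style
  of predicate transformers: every measurable predicate on the outcome pulls back to a
  measurable predicate. In this form the uncountable existential quantifiers vanish by induction.
\<close>

lemma pred_passes:
  fixes Q :: "'x \<times> real \<times> nat \<times> 'a \<times> nat \<times> bool \<Rightarrow> bool"
  assumes [measurable]: "Li \<in> borel_measurable X" "A \<in> borel_measurable X"
    "y \<in> borel_measurable X" "z \<in> borel_measurable X" "\<And>r. (\<lambda>\<xi>. \<sigma> \<xi> r) \<in> measurable X S"
    and "Measurable.pred (X \<Otimes>\<^sub>M (borel \<Otimes>\<^sub>M (count_space UNIV \<Otimes>\<^sub>M (borel \<Otimes>\<^sub>M
      (count_space UNIV \<Otimes>\<^sub>M count_space UNIV))))) Q"
  shows "Measurable.pred X (\<lambda>\<xi>. \<exists>L n y' T b.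
    passes f M \<beta> \<gamma> L\<^sub>d (Li \<xi>) (A \<xi>) (y \<xi>) (z \<xi>) (\<sigma> \<xi>) r L n y' T b \<and> Q (\<xi>, L, n, y', T, b))"
  using assms(6)
proof (induction r arbitrary: Q)
  case 0
  have "\<not> passes f M \<beta> \<gamma> L\<^sub>d Linit A y z \<sigma> 0 L n y' T b" for Linit A y z \<sigma> L n y' T b
    using passes_ge_1 by fastforce
  then show ?case by simp
next
  case (Suc r)
  note [measurable] = Suc.prems
  let ?Y = "X \<Otimes>\<^sub>M (borel \<Otimes>\<^sub>M (count_space UNIV \<Otimes>\<^sub>M (borel \<Otimes>\<^sub>M
      (count_space UNIV \<Otimes>\<^sub>M count_space UNIV)))) :: ('x \<times> real \<times> nat \<times> 'a \<times> nat \<times> bool) measure"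
  define L1 where "L1 \<xi> = max (Li \<xi> / \<beta>) L\<^sub>d" for \<xi>
  define x1 where "x1 \<xi> = step_x (A \<xi>) (y \<xi>) (z \<xi>) (L1 \<xi>)" for \<xi>
  define out1 where "out1 n \<xi> = M (aux_fun f (L1 \<xi>) (x1 \<xi>)) (x1 \<xi>) (\<sigma> \<xi> 1) n" for n \<xi>
  have L1 [measurable]: "L1 \<in> borel_measurable X" unfolding L1_def by measurable
  have L1_ge: "L\<^sub>d \<le> L1 \<xi>" for \<xi> by (simp add: L1_def)
  have x1 [measurable]: "x1 \<in> borel_measurable X" unfolding x1_def by measurable
  have [measurable]: "out1 n \<in> borel_measurable X" for n
    unfolding out1_def by (rule borel_measurable_output[OF L1 x1 _ L1_ge]) measurable
  have [measurable]: "Measurable.pred X (\<lambda>\<xi>. inner_run f M (L1 \<xi>) (x1 \<xi>) (\<sigma> \<xi> 1) n (out1 n \<xi>))" for n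
    unfolding out1_def by (rule pred_inner_run[OF L1 x1 _ L1_ge]) measurable
  define L2 where "L2 p = max (fst (snd p) / \<beta>) L\<^sub>d" for p :: "'x \<times> real \<times> nat \<times> 'a \<times> nat \<times> bool"
  define x2 where "x2 p = step_x (A (fst p)) (y (fst p)) (z (fst p)) (L2 p)" for p
  define out2 where "out2 n p = M (aux_fun f (L2 p) (x2 p)) (x2 p) (\<sigma> (fst p) (Suc r)) n" for n p
  have L2 [measurable]: "L2 \<in> borel_measurable ?Y" unfolding L2_def by measurable
  have L2_ge: "L\<^sub>d \<le> L2 p" for p by (simp add: L2_def)
  have x2 [measurable]: "x2 \<in> borel_measurable ?Y" unfolding x2_def by measurable
  have [measurable]: "out2 n \<in> borel_measurable ?Y" for n
    unfolding out2_def by (rule borel_measurable_output[OF L2 x2 _ L2_ge]) measurable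
  have [measurable]: "Measurable.pred ?Y
      (\<lambda>p. inner_run f M (L2 p) (x2 p) (\<sigma> (fst p) (Suc r)) n (out2 n p))" for n
    unfolding out2_def by (rule pred_inner_run[OF L2 x2 _ L2_ge]) measurable
  \<comment> \<open>The precondition of \<open>Q\<close> under one more pass. The output point is a
    function of the preceding outcome and of \<open>n'\<close>, so the only quantifier is over the
    countable \<open>n'\<close>.\<close>
  define Q' where "Q' p \<longleftrightarrow> \<not> snd (snd (snd (snd (snd p)))) \<and>
    (\<exists>n'. inner_run f M (L2 p) (x2 p) (\<sigma> (fst p) (Suc r)) n' (out2 n' p) \<and>
      Q (fst p, L2 p, n', out2 n' p, fst (snd (snd (snd (snd p)))) + n',
        real n' \<ge> \<gamma> * real (fst (snd (snd p))) \<or> L2 p = L\<^sub>d))" for p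
  have [measurable]: "Measurable.pred ?Y Q'" unfolding Q'_def by measurable
  note [measurable] = Suc.IH[OF this]
  have "(\<exists>L n y' T b. passes f M \<beta> \<gamma> L\<^sub>d (Li \<xi>) (A \<xi>) (y \<xi>) (z \<xi>) (\<sigma> \<xi>) (Suc r) L n y' T b \<and> Q (\<xi>, L, n, y', T, b))
    \<longleftrightarrow> (r = 0 \<and> (\<exists>n. inner_run f M (L1 \<xi>) (x1 \<xi>) (\<sigma> \<xi> 1) n (out1 n \<xi>) \<and> Q (\<xi>, L1 \<xi>, n, out1 n \<xi>, n, L1 \<xi> = L\<^sub>d)))
      \<or> (\<exists>L n y' T b. passes f M \<beta> \<gamma> L\<^sub>d (Li \<xi>) (A \<xi>) (y \<xi>) (z \<xi>) (\<sigma> \<xi>) r L n y' T b \<and> Q' (\<xi>, L, n, y', T, b))"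
    (is "?l \<xi> \<longleftrightarrow> ?a \<xi> \<or> ?b \<xi>") for \<xi>
  proof
    assume "?l \<xi>"
    then obtain L n y' T b where p: "passes f M \<beta> \<gamma> L\<^sub>d (Li \<xi>) (A \<xi>) (y \<xi>) (z \<xi>) (\<sigma> \<xi>) (Suc r) L n y' T b"
      and Q: "Q (\<xi>, L, n, y', T, b)" by blast
    from p consider (first) "r = 0" "L = L1 \<xi>" "inner_run f M L (step_x (A \<xi>) (y \<xi>) (z \<xi>) L) (\<sigma> \<xi> 1) n y'"
        "T = n" "b = (L = L\<^sub>d)"
      | (again) L0 n0 y0 T0 where "passes f M \<beta> \<gamma> L\<^sub>d (Li \<xi>) (A \<xi>) (y \<xi>) (z \<xi>) (\<sigma> \<xi>) r L0 n0 y0 T0 False"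
        "L = max (L0 / \<beta>) L\<^sub>d" "inner_run f M L (step_x (A \<xi>) (y \<xi>) (z \<xi>) L) (\<sigma> \<xi> (Suc r)) n y'"
        "T = T0 + n" "b = (real n \<ge> \<gamma> * real n0 \<or> L = L\<^sub>d)"
      unfolding passes_Suc_iff L1_def by blast
    then show "?a \<xi> \<or> ?b \<xi>"
    proof cases
      case first
      have "y' = out1 n \<xi>"
        using first(2,3) unfolding out1_def x1_def inner_run_def by simp
      then have "?a \<xi>" using first Q unfolding x1_def by blast
      then show ?thesis ..
    next
      case again
      let ?p = "(\<xi>, L0, n0, y0, T0, False)"
      have L: "L2 ?p = L" using again(2) by (simp add: L2_def)
      have "y' = out2 n ?p"
        using again(3) unfolding out2_def x2_def L inner_run_def by simp
      then have "Q' ?p"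
        using again(3-5) Q unfolding Q'_def L x2_def fst_conv snd_conv by blast
      then have "?b \<xi>" using again(1) by blast
      then show ?thesis ..
    qed
  next
    assume "?a \<xi> \<or> ?b \<xi>"
    then show "?l \<xi>"
    proof
      assume "?a \<xi>"
      then obtain n where "r = 0" "inner_run f M (L1 \<xi>) (x1 \<xi>) (\<sigma> \<xi> 1) n (out1 n \<xi>)"
        and Q: "Q (\<xi>, L1 \<xi>, n, out1 n \<xi>, n, L1 \<xi> = L\<^sub>d)" by blast
      then have "passes f M \<beta> \<gamma> L\<^sub>d (Li \<xi>) (A \<xi>) (y \<xi>) (z \<xi>) (\<sigma> \<xi>) (Suc r)
          (L1 \<xi>) n (out1 n \<xi>) n (L1 \<xi> = L\<^sub>d)"
        unfolding passes_Suc_iff by (simp add: L1_def x1_def)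
      then show ?thesis using Q by blast
    next
      assume "?b \<xi>"
      then obtain L n y' T b where p: "passes f M \<beta> \<gamma> L\<^sub>d (Li \<xi>) (A \<xi>) (y \<xi>) (z \<xi>) (\<sigma> \<xi>) r L n y' T b"
        and Q': "Q' (\<xi>, L, n, y', T, b)" by blast
      let ?p = "(\<xi>, L, n, y', T, b)"
      from Q' have b: "\<not> b" by (simp add: Q'_def)
      from Q' obtain n' where run: "inner_run f M (L2 ?p) (x2 ?p) (\<sigma> \<xi> (Suc r)) n' (out2 n' ?p)"
        and Q: "Q (\<xi>, L2 ?p, n', out2 n' ?p, T + n', real n' \<ge> \<gamma> * real n \<or> L2 ?p = L\<^sub>d)"
        unfolding Q'_def fst_conv snd_conv by blast
      from b p have "passes f M \<beta> \<gamma> L\<^sub>d (Li \<xi>) (A \<xi>) (y \<xi>) (z \<xi>) (\<sigma> \<xi>) r L n y' T False" by simp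
      moreover have "L2 ?p = max (L / \<beta>) L\<^sub>d" by (simp add: L2_def)
      ultimately have "passes f M \<beta> \<gamma> L\<^sub>d (Li \<xi>) (A \<xi>) (y \<xi>) (z \<xi>) (\<sigma> \<xi>) (Suc r)
          (L2 ?p) n' (out2 n' ?p) (T + n') (real n' \<ge> \<gamma> * real n \<or> L2 ?p = L\<^sub>d)"
        using run[unfolded x2_def fst_conv] by (rule passes.again)
      with Q show ?thesis by blast
    qed
  qed
  moreover have "Measurable.pred X (\<lambda>\<xi>. ?a \<xi> \<or> ?b \<xi>)" by measurable
  ultimately show ?case by (simp only:)
qed

text \<open>The predicate also receives \<omega>, because the next loop reads seeds from it; without
  this component the induction over \<open>k\<close> would not close.\<close>

lemma pred_outer:
  fixes Q :: "real \<times> real \<times> 'a \<times> 'a \<times> nat \<times> (nat \<times> nat \<Rightarrow> 's) \<Rightarrow> bool"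
  assumes "Measurable.pred (borel \<Otimes>\<^sub>M (borel \<Otimes>\<^sub>M (borel \<Otimes>\<^sub>M (borel \<Otimes>\<^sub>M
    (count_space UNIV \<Otimes>\<^sub>M seeds S))))) Q"
  shows "Measurable.pred (seeds S) (\<lambda>\<omega>. \<exists>L A y z T. outer \<omega> k L A y z T \<and> Q (L, A, y, z, T, \<omega>))"
  using assms
proof (induction k arbitrary: Q)
  case 0
  note [measurable] = 0
  have "Measurable.pred (seeds S) (\<lambda>\<omega>. Q (L0, 0, x0, x0, 0, \<omega>))" by measurable
  then show ?case by (simp add: catalyst_0_iff)
next
  case (Suc k)
  note [measurable] = Suc.prems
  let ?X = "borel \<Otimes>\<^sub>M (borel \<Otimes>\<^sub>M (borel \<Otimes>\<^sub>M (borel \<Otimes>\<^sub>M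
    (count_space UNIV \<Otimes>\<^sub>M seeds S)))) :: (real \<times> real \<times> 'a \<times> 'a \<times> nat \<times> (nat \<times> nat \<Rightarrow> 's)) measure"
  let ?L = "\<lambda>p. fst p" and ?A = "\<lambda>p. fst (snd p)" and ?y = "\<lambda>p. fst (snd (snd p))"
    and ?z = "\<lambda>p. fst (snd (snd (snd p)))" and ?T = "\<lambda>p. fst (snd (snd (snd (snd p))))"
    and ?\<omega> = "\<lambda>p. snd (snd (snd (snd (snd p))))"
  define Q1 where "Q1 q \<longleftrightarrow> (case q of (p, L', n, y', T1, b) \<Rightarrow>
    b \<and> Q (L', ?A p + step_a (?A p) L', y', ?z p - step_a (?A p) L' *\<^sub>R grad f y', ?T p + T1, ?\<omega> p))"
    for q :: "(real \<times> real \<times> 'a \<times> 'a \<times> nat \<times> (nat \<times> nat \<Rightarrow> 's)) \<times> real \<times> nat \<times> 'a \<times> nat \<times> bool"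
  have Q1: "Measurable.pred (?X \<Otimes>\<^sub>M (borel \<Otimes>\<^sub>M (count_space UNIV \<Otimes>\<^sub>M (borel \<Otimes>\<^sub>M
      (count_space UNIV \<Otimes>\<^sub>M count_space UNIV))))) Q1"
    unfolding Q1_def split_def by measurable
  have [measurable]: "(\<lambda>p. ?\<omega> p (k, r)) \<in> measurable ?X S" for r
    by (rule measurable_compose[OF _ measurable_seed]) measurable
  define Q' where "Q' p \<longleftrightarrow> (\<exists>r L' n y' T1 b. loop (?\<omega> p) k (?L p) (?A p) (?y p) (?z p) r L' n y' T1 b
    \<and> Q1 (p, L', n, y', T1, b))" for p
  have "Measurable.pred ?X (\<lambda>p. \<exists>L' n y' T1 b. loop (?\<omega> p) k (?L p) (?A p) (?y p) (?z p) r L' n y' T1 b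
    \<and> Q1 (p, L', n, y', T1, b))" for r
    by (rule pred_passes[OF _ _ _ _ _ Q1]) measurable
  note [measurable] = this
  have "Measurable.pred ?X Q'" unfolding Q'_def by measurable
  from Suc.IH[OF this] have "Measurable.pred (seeds S)
    (\<lambda>\<omega>. \<exists>L A y z T. outer \<omega> k L A y z T \<and> Q' (L, A, y, z, T, \<omega>))" .
  moreover have "(\<exists>L A y z T. outer \<omega> (Suc k) L A y z T \<and> Q (L, A, y, z, T, \<omega>))
    \<longleftrightarrow> (\<exists>L A y z T. outer \<omega> k L A y z T \<and> Q' (L, A, y, z, T, \<omega>))" for \<omega>
  proof
    assume "\<exists>L A y z T. outer \<omega> (Suc k) L A y z T \<and> Q (L, A, y, z, T, \<omega>)"
    then obtain L' A' y' z' T' where "outer \<omega> (Suc k) L' A' y' z' T'" and Q: "Q (L', A', y', z', T', \<omega>)"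
      by blast
    from this(1) obtain L A y z T r n T1 where outer: "outer \<omega> k L A y z T"
      and loop: "loop \<omega> k L A y z r L' n y' T1 True" and
      eq: "A' = A + step_a A L'" "z' = z - step_a A L' *\<^sub>R grad f y'" "T' = T + T1"
      unfolding catalyst_Suc_iff by blast
    have "Q1 ((L, A, y, z, T, \<omega>), L', n, y', T1, True)"
      using Q eq by (simp add: Q1_def)
    then have "Q' (L, A, y, z, T, \<omega>)"
      unfolding Q'_def fst_conv snd_conv using loop by blast
    then show "\<exists>L A y z T. outer \<omega> k L A y z T \<and> Q' (L, A, y, z, T, \<omega>)"
      using outer by blast
  next
    assume "\<exists>L A y z T. outer \<omega> k L A y z T \<and> Q' (L, A, y, z, T, \<omega>)"
    then obtain L A y z T r L' n y' T1 b where outer: "outer \<omega> k L A y z T"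
      and loop: "loop \<omega> k L A y z r L' n y' T1 b" and
      Q1: "Q1 ((L, A, y, z, T, \<omega>), L', n, y', T1, b)"
      unfolding Q'_def fst_conv snd_conv by blast
    have b: "b" and Q: "Q (L', A + step_a A L', y', z - step_a A L' *\<^sub>R grad f y', T + T1, \<omega>)"
      using Q1 by (simp_all add: Q1_def)
    from b loop have "loop \<omega> k L A y z r L' n y' T1 True" by simp
    from catalyst.step[OF outer this] Q
    show "\<exists>L A y z T. outer \<omega> (Suc k) L A y z T \<and> Q (L, A, y, z, T, \<omega>)" by blast
  qed
  ultimately show ?case by simp
qed

section \<open>Failure events and the union bound over slots\<close>

definition bad_seeds :: "real \<Rightarrow> nat \<Rightarrow> nat \<Rightarrow> (nat \<times> nat \<Rightarrow> 's) set" where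
  "bad_seeds \<delta> k r = {\<omega> \<in> space (seeds S). \<exists>L x. call \<omega> k r L x \<and>
    \<not> good_seed f M C C\<^sub>n L\<^sub>f L x (\<omega> (k, r)) (failure_share \<delta> k r)}"

text \<open>The quantifier over \<open>L\<close> and \<open>x\<close> is uncountable. Splitting the
  call into the state after \<open>k\<close> outer iterations and, for \<open>r = Suc j\<close>, the
  outcome of a pass \<open>j\<close> without exit brings it into the form that
  \<open>pred_outer\<close> and \<open>pred_passes\<close> handle.\<close>

lemma sets_bad_seeds: "bad_seeds \<delta> k r \<in> sets (seeds S)"
proof -
  define d where "d = failure_share \<delta> k r"
  let ?X = "borel \<Otimes>\<^sub>M (borel \<Otimes>\<^sub>M (borel \<Otimes>\<^sub>M (borel \<Otimes>\<^sub>M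
    (count_space UNIV \<Otimes>\<^sub>M seeds S)))) :: (real \<times> real \<times> 'a \<times> 'a \<times> nat \<times> (nat \<times> nat \<Rightarrow> 's)) measure"
  let ?Y = "?X \<Otimes>\<^sub>M (borel \<Otimes>\<^sub>M (count_space UNIV \<Otimes>\<^sub>M (borel \<Otimes>\<^sub>M
      (count_space UNIV \<Otimes>\<^sub>M count_space UNIV))))
      :: ((real \<times> real \<times> 'a \<times> 'a \<times> nat \<times> (nat \<times> nat \<Rightarrow> 's)) \<times> real \<times> nat \<times> 'a \<times> nat \<times> bool) measure"
  let ?L = "\<lambda>p. fst p" and ?A = "\<lambda>p. fst (snd p)" and ?y = "\<lambda>p. fst (snd (snd p))"
    and ?z = "\<lambda>p. fst (snd (snd (snd p)))" and ?\<omega> = "\<lambda>p. snd (snd (snd (snd (snd p))))"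
  define bad where "bad p L \<longleftrightarrow> \<not> good_seed f M C C\<^sub>n L\<^sub>f L (step_x (?A p) (?y p) (?z p) L) (?\<omega> p (k, r)) d"
    for p :: "real \<times> real \<times> 'a \<times> 'a \<times> nat \<times> (nat \<times> nat \<Rightarrow> 's)" and L
  define L1 where "L1 p = max (\<beta> * min (\<alpha> * ?L p) L\<^sub>u / \<beta>) L\<^sub>d"
    for p :: "real \<times> real \<times> 'a \<times> 'a \<times> nat \<times> (nat \<times> nat \<Rightarrow> 's)"
  define L2 where "L2 q = max (fst (snd q) / \<beta>) L\<^sub>d"
    for q :: "(real \<times> real \<times> 'a \<times> 'a \<times> nat \<times> (nat \<times> nat \<Rightarrow> 's)) \<times> real \<times> nat \<times> 'a \<times> nat \<times> bool"
  have [measurable]: "(\<lambda>p. ?\<omega> p (k, j)) \<in> measurable ?X S" for j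
    by (rule measurable_compose[OF _ measurable_seed]) measurable
  have [measurable]: "L1 \<in> borel_measurable ?X" unfolding L1_def by measurable
  have [measurable]: "L2 \<in> borel_measurable ?Y" unfolding L2_def by measurable
  have [measurable]: "Measurable.pred ?X (\<lambda>p. good_seed f M C C\<^sub>n L\<^sub>f (L1 p) (step_x (?A p) (?y p) (?z p) (L1 p)) (?\<omega> p (k, r)) d)"
    by (rule pred_good_seed) (measurable, simp add: L1_def)
  have [measurable]: "Measurable.pred ?Y (\<lambda>q. good_seed f M C C\<^sub>n L\<^sub>f (L2 q)
      (step_x (?A (fst q)) (?y (fst q)) (?z (fst q)) (L2 q)) (?\<omega> (fst q) (k, r)) d)"
    by (rule pred_good_seed) (measurable, simp add: L2_def)
  define Q1 where "Q1 q \<longleftrightarrow> \<not> snd (snd (snd (snd (snd q)))) \<and> bad (fst q) (L2 q)" for q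
  have Q1: "Measurable.pred ?Y Q1" unfolding Q1_def bad_def by measurable
  have [measurable]: "Measurable.pred ?X (\<lambda>p. \<exists>L' n y' T1 b. loop (?\<omega> p) k (?L p) (?A p) (?y p) (?z p) j L' n y' T1 b
    \<and> Q1 (p, L', n, y', T1, b))" for j
    by (rule pred_passes[OF _ _ _ _ _ Q1]) measurable
  define Q where "Q p \<longleftrightarrow> (r = 1 \<and> bad p (L1 p)) \<or> (\<exists>j. r = Suc j \<and>
    (\<exists>L' n y' T1 b. loop (?\<omega> p) k (?L p) (?A p) (?y p) (?z p) j L' n y' T1 b \<and> Q1 (p, L', n, y', T1, b)))" for p
  have "Measurable.pred ?X Q" unfolding Q_def bad_def by measurable
  from pred_outer[OF this, of k]
  have "{\<omega> \<in> space (seeds S). \<exists>L A y z T. outer \<omega> k L A y z T \<and> Q (L, A, y, z, T, \<omega>)} \<in> sets (seeds S)"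
    by (rule predE)
  moreover have "(\<exists>L x. call \<omega> k r L x \<and> \<not> good_seed f M C C\<^sub>n L\<^sub>f L x (\<omega> (k, r)) (failure_share \<delta> k r))
    \<longleftrightarrow> (\<exists>L A y z T. outer \<omega> k L A y z T \<and> Q (L, A, y, z, T, \<omega>))" for \<omega>
  proof
    assume "\<exists>L x. call \<omega> k r L x \<and> \<not> good_seed f M C C\<^sub>n L\<^sub>f L x (\<omega> (k, r)) (failure_share \<delta> k r)"
    then obtain L x where call: "call \<omega> k r L x"
      and bad: "\<not> good_seed f M C C\<^sub>n L\<^sub>f L x (\<omega> (k, r)) d" by (auto simp: d_def)
    from call show "\<exists>L A y z T. outer \<omega> k L A y z T \<and> Q (L, A, y, z, T, \<omega>)"
    proof cases
      case (first L' A y z T)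
      have "Q (L', A, y, z, T, \<omega>)"
        using first bad unfolding Q_def bad_def L1_def fst_conv snd_conv by simp
      then show ?thesis using first(3) by blast
    next
      case (again L' A y z T j L1 n y' T')
      have "Q1 ((L', A, y, z, T, \<omega>), L1, n, y', T', False)"
        using again(2,5) bad by (simp add: Q1_def bad_def L2_def)
      then have "Q (L', A, y, z, T, \<omega>)"
        unfolding Q_def fst_conv snd_conv using again(1,4) by blast
      then show ?thesis using again(3) by blast
    qed
  next
    assume "\<exists>L A y z T. outer \<omega> k L A y z T \<and> Q (L, A, y, z, T, \<omega>)"
    then obtain L A y z T where outer: "outer \<omega> k L A y z T" and "Q (L, A, y, z, T, \<omega>)" by blast
    from this(2) consider (first) "r = 1" "bad (L, A, y, z, T, \<omega>) (L1 (L, A, y, z, T, \<omega>))"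
      | (again) j L' n y' T1 b where "r = Suc j" "loop \<omega> k L A y z j L' n y' T1 b"
        "Q1 ((L, A, y, z, T, \<omega>), L', n, y', T1, b)"
      unfolding Q_def fst_conv snd_conv by blast
    then show "\<exists>L x. call \<omega> k r L x \<and> \<not> good_seed f M C C\<^sub>n L\<^sub>f L x (\<omega> (k, r)) (failure_share \<delta> k r)"
    proof cases
      case first
      then show ?thesis
        using inner_call.first[OF outer refl] unfolding bad_def L1_def d_def fst_conv snd_conv by blast
    next
      case again
      then have b: "\<not> b" and bad: "bad (L, A, y, z, T, \<omega>) (max (L' / \<beta>) L\<^sub>d)"
        by (simp_all add: Q1_def L2_def)
      from b again(2) have "loop \<omega> k L A y z j L' n y' T1 False" by simp
      from inner_call.again[OF outer this refl] bad show ?thesis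
        unfolding again(1) bad_def d_def fst_conv snd_conv by blast
    qed
  qed
  ultimately show ?thesis unfolding bad_seeds_def by simp
qed

text \<open>For fixed parameters the rate is invoked at the single time \<open>t\<close>, with the
  share \<open>d\<close> as its failure probability.\<close>

lemma measure_not_good_seed_le:
  assumes L: "L\<^sub>d \<le> L" and d: "0 < d" "d \<le> 1 / 4"
  shows "measure S {s \<in> space S. \<not> good_seed f M C C\<^sub>n L\<^sub>f L x s d} \<le> d"
proof -
  have L0: "0 < L" using L Ld_pos by simp
  obtain ystar where ystar: "\<And>y. aux_fun f L x ystar \<le> aux_fun f L x y"
    using minimizer_aux_fun[OF L0, of x] by blast
  define t where "t = nat \<lceil>work_bound C C\<^sub>n L\<^sub>f L d\<rceil>"
  let ?G = "{s \<in> space S. good_seed f M C C\<^sub>n L\<^sub>f L x s d}"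
  let ?R = "{s \<in> space S. aux_fun f L x (M (aux_fun f L x) x s t) - aux_fun f L x ystar
    \<le> C * (L\<^sub>f + L) * (norm (x - ystar))\<^sup>2 * ln (real t / d) * rate C\<^sub>n L (L\<^sub>f + L) t}"
  have G: "?G \<in> sets S"
    by (rule predE, rule pred_good_seed) (auto simp: L)
  have t: "1 \<le> t"
    using work_bound_pos[OF less_imp_le[OF Lf_pos] L0 C_pos Cn d(1)] d(2) unfolding t_def by linarith
  have "1 - d \<le> measure S ?R"
    using method_rate[OF L0, of x] ystar t d unfolding randomized_rate_def by simp
  also have "\<dots> \<le> measure S ?G"
    using good_seed_of_rate[OF convex smooth L0 ystar C_pos Cn d]
    by (intro S.finite_measure_mono G) (auto simp: t_def)
  also have "\<dots> = 1 - measure S (space S - ?G)" by (simp add: S.prob_compl G)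
  finally have "measure S (space S - ?G) \<le> d" by simp
  moreover have "space S - ?G = {s \<in> space S. \<not> good_seed f M C C\<^sub>n L\<^sub>f L x s d}" by auto
  ultimately show ?thesis by simp
qed

text \<open>Resampling the seed of the slot changes neither whether a run takes place there nor its
  parameters, so for all other seeds fixed the event is about one run with fixed parameters, or
  empty.\<close>

lemma measure_bad_seeds_le:
  assumes \<delta>: "0 < \<delta>" "\<delta> < 1" and r: "1 \<le> r"
  shows "measure (seeds S) (bad_seeds \<delta> k r) \<le> failure_share \<delta> k r"
proof (rule measure_seeds_le[where i = "(k, r)", OF S.prob_space_axioms sets_bad_seeds])
  note d = failure_share_bounds[OF \<delta> r, of k]
  show "0 \<le> failure_share \<delta> k r" using d by simp
  fix \<omega> assume \<omega>: "\<omega> \<in> space (seeds S)"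
  have call: "call (fun_upd \<omega> (k, r) s) k r L x \<longleftrightarrow> call \<omega> k r L x" for s L x
    by (rule iffI; erule inner_call_cong_seed) auto
  show "measure S {s \<in> space S. fun_upd \<omega> (k, r) s \<in> bad_seeds \<delta> k r} \<le> failure_share \<delta> k r"
  proof (cases "\<exists>L x. call \<omega> k r L x")
    case True
    then obtain L x where Lx: "call \<omega> k r L x" by blast
    then have uniq: "call \<omega> k r L' x' \<longleftrightarrow> L' = L \<and> x' = x" for L' x'
      using inner_call_unique by blast
    have "fun_upd \<omega> (k, r) s \<in> space (seeds S)" if "s \<in> space S" for s
      using \<omega> that by (auto simp: seeds_def space_PiM)
    then have "{s \<in> space S. fun_upd \<omega> (k, r) s \<in> bad_seeds \<delta> k r}
      = {s \<in> space S. \<not> good_seed f M C C\<^sub>n L\<^sub>f L x s (failure_share \<delta> k r)}"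
      by (auto simp: bad_seeds_def call uniq)
    then show ?thesis using measure_not_good_seed_le[OF _ d] inner_call_ge[OF Lx] by simp
  next
    case False
    then have "{s \<in> space S. fun_upd \<omega> (k, r) s \<in> bad_seeds \<delta> k r} = {}"
      by (auto simp: bad_seeds_def call)
    then show ?thesis using d by (simp only: measure_empty)
  qed
qed

lemma measure_good_run:
  assumes \<delta>: "0 < \<delta>" "\<delta> < 1"
  shows "\<exists>G \<in> sets (seeds S). G \<subseteq> {\<omega>. good_run \<delta> \<omega>} \<and> 1 - \<delta> \<le> measure (seeds S) G"
proof -
  interpret P: prob_space "seeds S" by (rule prob_space_seeds) unfold_locales
  let ?c = "\<lambda>n. 1 / ((real n + 1) * (real n + 2))"
  \<comment> \<open>\<open>Suc r\<close>, because the passes of a loop are numbered from 1.\<close>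
  define Bad where "Bad k = (\<Union>r. bad_seeds \<delta> k (Suc r))" for k
  have sets: "Bad k \<in> sets (seeds S)" for k
    unfolding Bad_def using sets_bad_seeds by blast
  have Bad: "measure (seeds S) (Bad k) \<le> \<delta> * ?c k" for k
  proof -
    have share: "failure_share \<delta> k (Suc r) = \<delta> * ?c k * ?c r" for r
      by (simp add: failure_share_def add.commute)
    have le: "measure (seeds S) (bad_seeds \<delta> k (Suc r)) \<le> \<delta> * ?c k * ?c r" for r
      using measure_bad_seeds_le[OF \<delta>, of "Suc r" k] by (simp only: share)
    have sums: "(\<lambda>r. \<delta> * ?c k * ?c r) sums (\<delta> * ?c k * 1)"
      by (rule sums_mult[OF sums_inverse_consecutive])
    have summable: "summable (\<lambda>r. measure (seeds S) (bad_seeds \<delta> k (Suc r)))"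
      by (rule summable_comparison_test'[OF sums_summable[OF sums], of 0]) (use le in auto)
    have "measure (seeds S) (Bad k) \<le> (\<Sum>r. measure (seeds S) (bad_seeds \<delta> k (Suc r)))"
      unfolding Bad_def using sets_bad_seeds summable
      by (intro P.finite_measure_subadditive_countably) auto
    also have "\<dots> \<le> (\<Sum>r. \<delta> * ?c k * ?c r)"
      by (rule suminf_le[OF le summable sums_summable[OF sums]])
    also have "\<dots> = \<delta> * ?c k" by (simp only: sums_unique[OF sums, symmetric] mult_1_right)
    finally show ?thesis .
  qed
  have sums: "(\<lambda>k. \<delta> * ?c k) sums (\<delta> * 1)"
    by (rule sums_mult[OF sums_inverse_consecutive])
  have summable: "summable (\<lambda>k. measure (seeds S) (Bad k))"
    by (rule summable_comparison_test'[OF sums_summable[OF sums], of 0]) (use Bad in auto)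
  have "measure (seeds S) (\<Union>k. Bad k) \<le> (\<Sum>k. measure (seeds S) (Bad k))"
    using sets summable by (intro P.finite_measure_subadditive_countably) auto
  also have "\<dots> \<le> (\<Sum>k. \<delta> * ?c k)"
    by (rule suminf_le[OF Bad summable sums_summable[OF sums]])
  also have "\<dots> = \<delta>" using sums_unique[OF sums] by simp
  finally have "1 - \<delta> \<le> measure (seeds S) (space (seeds S) - (\<Union>k. Bad k))"
    using P.prob_compl[of "\<Union>k. Bad k"] sets by auto
  moreover have "good_run \<delta> \<omega>" if "\<omega> \<in> space (seeds S) - (\<Union>k. Bad k)" for \<omega>
    unfolding good_run_def
  proof (intro allI impI)
    fix k r L x assume call: "call \<omega> k r L x"
    then obtain j where "r = Suc j" using inner_call_ge by (cases r) fastforce+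
    then have "\<omega> \<notin> bad_seeds \<delta> k r" using that by (auto simp: Bad_def)
    then show "good_seed f M C C\<^sub>n L\<^sub>f L x (\<omega> (k, r)) (failure_share \<delta> k r)"
      using call that by (auto simp: bad_seeds_def)
  qed
  ultimately show ?thesis
    using sets by (intro bexI[of _ "space (seeds S) - (\<Union>k. Bad k)"]) auto
qed

text \<open>Monotonicity of \<open>measure\<close> requires this: a non-measurable superset of the
  good event would have measure 0.\<close>

lemma sets_within_budget:
  "{\<omega> \<in> space (seeds S). \<exists>N L A y z T. outer \<omega> N L A y z T \<and> f y - f xstar \<le> \<epsilon> \<and> real T \<le> b}
    \<in> sets (seeds S)"
proof -
  have "Measurable.pred (borel \<Otimes>\<^sub>M (borel \<Otimes>\<^sub>M (borel \<Otimes>\<^sub>M (borel \<Otimes>\<^sub>M (count_space UNIV \<Otimes>\<^sub>M seeds S)))))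
    (\<lambda>(L, A, y, z, T, \<omega>). f y - f xstar \<le> \<epsilon> \<and> real T \<le> b)"
    unfolding split_def by measurable
  from pred_outer[OF this]
  have [measurable]: "Measurable.pred (seeds S)
    (\<lambda>\<omega>. \<exists>L A y z T. outer \<omega> N L A y z T \<and> f y - f xstar \<le> \<epsilon> \<and> real T \<le> b)" for N
    by simp
  show ?thesis by measurable
qed

end

theorem theorem2:
  fixes f :: "real ^ 'n \<Rightarrow> real"
    and x0 xstar :: "real ^ 'n"
    and S :: "'s measure"
    and M :: "(real ^ 'n, 's) inner_method"
    and \<alpha> \<beta> \<gamma> L0 L\<^sub>d L\<^sub>u L\<^sub>f C C\<^sub>n R \<epsilon> \<delta> \<kappa> :: real
  assumes "convex_on UNIV f"
    and "smooth_fun L\<^sub>f f"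
    and "\<forall>y. f xstar \<le> f y"
    and "0 < L\<^sub>d" and "L\<^sub>d < L\<^sub>u" and "L\<^sub>d \<le> L\<^sub>f" and "L\<^sub>f \<le> L\<^sub>u"
    and "0 < L0"
    and "1 < \<gamma>" and "1 < \<beta>" and "\<beta> < \<alpha>"
    and "prob_space S"
    and "0 < C" and "1 \<le> C\<^sub>n"
    and "rate_assumption S M C C\<^sub>n f L\<^sub>f"
    and "R = norm (x0 - xstar)"
    and "0 < \<epsilon>" and "0 < \<delta>" and "\<delta> < 1"
    and "0 < \<kappa>" and "R = 0 \<or> \<epsilon> \<le> \<kappa> * (L\<^sub>d * R\<^sup>2)"
  shows "measure (seeds S)
      {\<omega> \<in> space (seeds S). \<exists>N L A y z T.
         catalyst f M \<alpha> \<beta> \<gamma> L\<^sub>d L\<^sub>u L0 x0 \<omega> N L A y z T \<and>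
         f y - f xstar \<le> \<epsilon> \<and>
         real T \<le> bound_const \<alpha> \<beta> C \<kappa> * log_factor C\<^sub>n L\<^sub>d L\<^sub>u L\<^sub>f R \<epsilon> \<delta> *
           (C\<^sub>n * max (sqrt (L\<^sub>u / L\<^sub>f)) (sqrt (L\<^sub>f / L\<^sub>d)) * sqrt (L\<^sub>f * R\<^sup>2 / \<epsilon>))}
    \<ge> 1 - \<delta>"
    (is "measure _ {\<omega> \<in> _. ?E \<omega>} \<ge> _")
proof -
  interpret catalyst_problem f M \<alpha> \<beta> \<gamma> L0 L\<^sub>d L\<^sub>u L\<^sub>f C C\<^sub>n x0 xstar
    using assms by unfold_locales auto
  interpret P: prob_space "seeds S" using assms by (intro prob_space_seeds)
  \<comment> \<open>With a deterministic method no measurability is assumed; the event is then shown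
    to be the whole space.\<close>
  have certain: ?thesis if "\<And>\<omega>. \<omega> \<in> space (seeds S) \<Longrightarrow> ?E \<omega>"
  proof -
    have "{\<omega> \<in> space (seeds S). ?E \<omega>} = space (seeds S)" using that by blast
    then show ?thesis using \<open>0 < \<delta>\<close> by (simp only: P.prob_space)
  qed
  show ?thesis
  proof (cases "R = 0")
    \<comment> \<open>The start is already a solution, so zero outer iterations do, with no work;
      the bound is 0 as well.\<close>
    case True
    then have "x0 = xstar" using assms by simp
    then have "?E \<omega>" for \<omega>
      using catalyst.init[of f M \<alpha> \<beta> \<gamma> L\<^sub>d L\<^sub>u L0 x0 \<omega>] True \<open>0 < \<epsilon>\<close>
      by (intro exI[of _ 0] exI[of _ L0] exI[of _ x0]) auto
    then show ?thesis by (rule certain)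
  next
    case False
    have good: "?E \<omega>" if "good_run \<delta> \<omega>" for \<omega>
      using good_run_complexity[OF that] assms False by blast
    from \<open>rate_assumption S M C C\<^sub>n f L\<^sub>f\<close> consider
      (randomized) "\<And>t. (\<lambda>(L, x, s). M (aux_fun f L x) x s t)
          \<in> borel_measurable (restrict_space borel {0<..} \<Otimes>\<^sub>M (borel \<Otimes>\<^sub>M S))"
        "\<And>L x. 0 < L \<Longrightarrow> randomized_rate S M C C\<^sub>n (aux_fun f L x) L (L\<^sub>f + L)"
      | (deterministic) "\<And>L x. 0 < L \<Longrightarrow> deterministic_rate S M C C\<^sub>n (aux_fun f L x) L (L\<^sub>f + L)"
      unfolding rate_assumption_def by blast
    then show ?thesis
    proof cases
      case randomized
      interpret S: prob_space S by fact
      interpret randomized_problem f M \<alpha> \<beta> \<gamma> L0 L\<^sub>d L\<^sub>u L\<^sub>f C C\<^sub>n x0 xstar S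
        by unfold_locales (use randomized in auto)
      obtain G where G: "G \<in> sets (seeds S)" "G \<subseteq> {\<omega>. good_run \<delta> \<omega>}"
        "1 - \<delta> \<le> measure (seeds S) G"
        using measure_good_run[OF \<open>0 < \<delta>\<close> \<open>\<delta> < 1\<close>] by blast
      have "G \<subseteq> {\<omega> \<in> space (seeds S). ?E \<omega>}"
      proof
        fix \<omega> assume \<omega>: "\<omega> \<in> G"
        then have "good_run \<delta> \<omega>" "\<omega> \<in> space (seeds S)"
          using G(2) sets.sets_into_space[OF G(1)] by auto
        from this(2) good[OF this(1)] show "\<omega> \<in> {\<omega> \<in> space (seeds S). ?E \<omega>}"
          by (intro CollectI conjI)
      qed
      then have "measure (seeds S) G \<le> measure (seeds S) {\<omega> \<in> space (seeds S). ?E \<omega>}"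
        by (rule P.finite_measure_mono[OF _ sets_within_budget])
      with G(3) show ?thesis by (rule order_trans)
    next
      case deterministic
      show ?thesis
      proof (rule certain, rule good)
        fix \<omega> assume \<omega>: "\<omega> \<in> space (seeds S)"
        show "good_run \<delta> \<omega>"
          by (rule good_run_of_deterministic_rate[OF _ \<open>0 < \<delta>\<close> \<open>\<delta> < 1\<close> \<omega>]) (rule deterministic)
      qed
    qed
  qed
qed

end
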